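(* Let $G$ be a bipartite graph with $e\ge 4$ edges and without isolated vertices such that $\rho(G)=\rho(e)$. Then: (i) If $e$ is odd, then $G\cong K^-_{2,q}$ where $q=(e+1)/2$. (ii) If $e$ is even, $e-1$ is prime and $e+1$ is not prime, then $G\cong K^-_{p',q'}$, where $p'\ge 3$ is the least integer (greater than $1$) dividing $e+1$ and $q'=(e+1)/p'$. (iii) If $e$ is even, $e-1$ is not prime and $e+1$ is prime, then $G\cong K^+_{p'',q''}$, where $p''\ge 3$ is the least integer (greater than $1$) dividing $e-1$ and $q''=(e-1)/p''$. (iv) If $e$ is even and neither $e-1$ nor $e+1$ is prime, then $G\in\{K^-_{p',q'},K^+_{p'',q''}\}$ (up to isomorphism), with $p',q'$ as in (ii) and $p'',q''$ as in (iii).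
   Context: The spectral radius $\rho(G)$ is the largest eigenvalue of the adjacency matrix of $G$. For $e\ge 2$, $\rho(e)$ denotes the maximum of $\rho(G)$ over all bipartite graphs $G$ with $e$ edges that are not the union of a complete bipartite graph and (possibly zero) isolated vertices. For $2\le s\le t$, $K_{s,t}$ is the complete bipartite graph with parts of orders $s$ and $t$; $K^-_{s,t}$ is obtained from $K_{s,t}$ by deleting one edge; $K^+_{s,t}$ is obtained from $K_{s,t}$ by adding a new vertex $x$ and a new edge $xy$, where $y$ is a vertex in the part of order $s$. *)

theory Defs
  imports
    "HOL-Computational_Algebra.Primes"
    "Jordan_Normal_Form.Spectral_Radius"
    "Graph_Theory.Kuratowski"
    "Graph_Theory.Digraph_Isomorphism"
begin

text \<open>
  Finite simple graphs are the symmetric loop-free digraphs of the locale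
  \<^locale>\<open>pair_graph\<close>: an undirected edge \<open>uv\<close> is represented by the two arcs
  \<open>(u, v)\<close> and \<open>(v, u)\<close>, hence the following set of undirected edges.
\<close>

definition edges :: "'a pair_pre_digraph \<Rightarrow> 'a set set" where
  "edges G = (\<lambda>(u, v). {u, v}) ` parcs G"

definition bipartite :: "'a pair_pre_digraph \<Rightarrow> bool" where
  "bipartite G \<longleftrightarrow>
     (\<exists>A B. pverts G = A \<union> B \<and> A \<inter> B = {} \<and> parcs G \<subseteq> A \<times> B \<union> B \<times> A)"

definition no_isolated_vertices :: "'a pair_pre_digraph \<Rightarrow> bool" where
  "no_isolated_vertices G \<longleftrightarrow> (\<forall>u\<in>pverts G. \<exists>v. (u, v) \<in> parcs G)"

text \<open>The vertices outside \<open>U\<close> are the isolated ones.\<close>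

definition complete_bipartite_plus_isolated :: "'a pair_pre_digraph \<Rightarrow> bool" where
  "complete_bipartite_plus_isolated G \<longleftrightarrow>
     (\<exists>U \<subseteq> pverts G. \<exists>m\<ge>1. \<exists>n\<ge>1.
        complete_bipartite_digraph m n (with_proj \<lparr>pverts = U, parcs = parcs G\<rparr>))"

definition adjacency_matrix :: "'a list \<Rightarrow> 'a pair_pre_digraph \<Rightarrow> real mat" where
  "adjacency_matrix vs G =
     mat (length vs) (length vs) (\<lambda>(i, j). if (vs ! i, vs ! j) \<in> parcs G then 1 else 0)"

text \<open>
  The vertices are ordered in an arbitrary way; another order conjugates the
  adjacency matrix by a permutation matrix and leaves the spectrum unchanged.
  The spectrum consists of the real eigenvalues, which are all eigenvalues as the
  matrix is symmetric.
\<close>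

definition rho :: "'a pair_pre_digraph \<Rightarrow> real" where
  "rho G = Max (spectrum (adjacency_matrix (SOME vs. distinct vs \<and> set vs = pverts G) G))"

text \<open>
  Every finite graph has an isomorphic copy with vertices in \<^typ>\<open>nat\<close>, so the maximum
  over all graphs is taken over those.  There is no bound on the number of vertices
  (isolated vertices are allowed here); hence \<^const>\<open>Greatest\<close> rather than \<^const>\<open>Max\<close>.
\<close>

definition rho_max :: "nat \<Rightarrow> real" where
  "rho_max e = (GREATEST r. \<exists>G :: nat pair_pre_digraph.
     pair_graph G \<and> bipartite G \<and> card (edges G) = e \<and>
     \<not> complete_bipartite_plus_isolated G \<and> r = rho G)"

text \<open>\<open>Inl\<close> tags the part of order \<open>s\<close>, \<open>Inr\<close> the part of order \<open>t\<close>.\<close>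

definition K_complete :: "nat \<Rightarrow> nat \<Rightarrow> (nat + nat) pair_pre_digraph" where
  "K_complete s t =
     (let S = Inl ` {..<s}; T = Inr ` {..<t}
      in \<lparr>pverts = S \<union> T, parcs = S \<times> T \<union> T \<times> S\<rparr>)"

lemma complete_bipartite_K_complete:
  "complete_bipartite_digraph s t (with_proj (K_complete s t))"
  unfolding complete_bipartite_digraph_pair_def K_complete_def Let_def
  by (intro conjI exI[of _ "Inl ` {..<s}"] exI[of _ "Inr ` {..<t}"])
     (auto simp: card_image)

definition K_minus :: "nat \<Rightarrow> nat \<Rightarrow> (nat + nat) pair_pre_digraph" where
  "K_minus s t =
     \<lparr>pverts = pverts (K_complete s t),
      parcs = parcs (K_complete s t) - {(Inl 0, Inr 0), (Inr 0, Inl 0)}\<rparr>"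

text \<open>The new vertex is \<open>Inr t\<close>, attached to the vertex \<open>Inl 0\<close> of the part of order \<open>s\<close>.\<close>

definition K_plus :: "nat \<Rightarrow> nat \<Rightarrow> (nat + nat) pair_pre_digraph" where
  "K_plus s t =
     \<lparr>pverts = insert (Inr t) (pverts (K_complete s t)),
      parcs = parcs (K_complete s t) \<union> {(Inl 0, Inr t), (Inr t, Inl 0)}\<rparr>"

definition least_divisor :: "nat \<Rightarrow> nat" where
  "least_divisor n = (LEAST p. p > 1 \<and> p dvd n)"

abbreviation graph_iso :: "'a pair_pre_digraph \<Rightarrow> 'b pair_pre_digraph \<Rightarrow> bool"
  (infix \<open>\<simeq>\<^sub>G\<close> 50) where
  "G \<simeq>\<^sub>G H \<equiv> digraph_iso (with_proj G) (with_proj H)"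

end

theory Submission
  imports Defs "HOL-Analysis.Convex" "HOL-Combinatorics.Permutations"
begin

text \<open>
  Let \<open>M\<close> be the biadjacency matrix of a bipartite graph with \<open>e\<close> edges.  The square
  \<open>\<mu> = \<rho>\<^sup>2\<close> of the spectral radius is an eigenvalue of \<open>M M\<^sup>T\<close>, so \<open>\<mu>\<^sup>2\<close> is at most the
  squared Frobenius norm of \<open>M M\<^sup>T\<close>, which counts the pairs of edges \<open>ab\<close>, \<open>a'b'\<close> such
  that \<open>ab'\<close> and \<open>a'b\<close> are edges too.  Hence \<open>\<mu>\<^sup>2 \<le> e\<^sup>2 - D\<close>, with \<open>D\<close> the number of the
  remaining (bad) pairs.

  For a complete bipartite graph minus a biclique, \<open>\<mu>\<close> is the larger root of
  \<open>\<mu>\<^sup>2 - e \<mu> + c\<close> with \<open>2 c = D\<close>, and \<open>e - \<mu> < 1\<close> when \<open>c \<le> e - 2\<close>.  By integrality of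
  \<open>D\<close>, an extremal graph has at most \<open>2 c\<close> bad pairs, for each such competitor.

  A graph which is not complete bipartite and has at most \<open>2 (e - 3)\<close> bad pairs is
  \<open>K\<^sup>-\<^sub>s\<^sub>,\<^sub>t\<close> or \<open>K\<^sup>+\<^sub>s\<^sub>,\<^sub>t\<close>.  If some side has no vertex joined to the whole other side, the bad pairs
  connect all edges, so \<open>D \<ge> 2 (e - 1)\<close>; otherwise a direct count gives \<open>D \<ge> 2 (e - 2)\<close>
  unless the missing edges form a biclique.  The parameters \<open>s, t\<close> are then determined by
  comparing with the competitors of the theorem.
\<close>

section \<open>Spectra of graphs\<close>

text \<open>A complex eigenvector always exists; symmetry makes its eigenvalue real, and then its
  real or its imaginary part is a real eigenvector. This keeps the \<open>Max\<close> in
  \<open>rho\<close> from being taken over the empty set.\<close>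

lemma real_symmetric_spectrum_nonempty:
  fixes A :: "real mat"
  assumes A: "A \<in> carrier_mat n n" and n: "n > 0"
    and sym: "\<And>i j. i < n \<Longrightarrow> j < n \<Longrightarrow> A $$ (i, j) = A $$ (j, i)"
  shows "spectrum A \<noteq> {}"
proof -
  let ?C = "map_mat complex_of_real A"
  have C: "?C \<in> carrier_mat n n" using A by simp
  obtain k v where v: "v \<in> carrier_vec n" "v \<noteq> 0\<^sub>v n" "?C *\<^sub>v v = k \<cdot>\<^sub>v v"
    using spectrum_non_empty[OF C] n A
    by (auto simp: spectrum_def eigenvalue_def eigenvector_def)
  have eq: "(\<Sum>j<n. of_real (A $$ (i, j)) * v $ j) = k * v $ i" if "i < n" for i
  proof -
    have "(?C *\<^sub>v v) $ i = (\<Sum>j<n. of_real (A $$ (i, j)) * v $ j)"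
      using that A v(1) by (simp add: scalar_prod_def atLeast0LessThan)
    then show ?thesis using v that by simp
  qed
  \<comment> \<open>\<open>S\<close> is the Hermitian form of \<open>A\<close> at \<open>v\<close>
    and \<open>N\<close> the squared norm of \<open>v\<close>. \<open>S\<close> equals its own
    conjugate and also \<open>k\<close> times \<open>N\<close>, and \<open>N > 0\<close>, so
    \<open>k\<close> is real.\<close>
  define S where "S = (\<Sum>i<n. \<Sum>j<n. cnj (v $ i) * of_real (A $$ (i, j)) * v $ j)"
  define N where "N = (\<Sum>i<n. (cmod (v $ i))\<^sup>2)"
  have "S = (\<Sum>i<n. cnj (v $ i) * (k * v $ i))"
    unfolding S_def by (rule sum.cong) (auto simp: mult.assoc eq sum_distrib_left[symmetric])
  also have "\<dots> = k * of_real N"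
    unfolding N_def of_real_sum sum_distrib_left
    by (rule sum.cong) (simp_all add: complex_norm_square[unfolded of_real_power] algebra_simps)
  finally have SN: "S = k * of_real N" .
  have "cnj S = (\<Sum>i<n. \<Sum>j<n. v $ i * of_real (A $$ (i, j)) * cnj (v $ j))"
    by (simp add: S_def)
  also have "\<dots> = S"
    unfolding S_def by (subst sum.swap) (intro sum.cong, auto simp: sym algebra_simps)
  finally have "cnj S = S" .
  obtain i0 where i0: "i0 < n" "v $ i0 \<noteq> 0" using v(1,2) by (auto simp: vec_eq_iff)
  have "N > 0"
    unfolding N_def using i0 by (intro sum_pos2[where i = i0]) auto
  with \<open>cnj S = S\<close> SN have "cnj k = k" by simp
  then have k: "k = of_real (Re k)" by (simp add: complex_eq_iff)
  have eigvec: "Re k \<in> spectrum A"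
    if w: "\<And>i. i < n \<Longrightarrow> (\<Sum>j<n. A $$ (i, j) * w j) = Re k * w i" "w i0 \<noteq> 0" for w
  proof -
    have "A *\<^sub>v vec n w = Re k \<cdot>\<^sub>v vec n w"
      using A w(1) by (intro eq_vecI) (simp_all add: scalar_prod_def atLeast0LessThan)
    moreover have "vec n w \<noteq> 0\<^sub>v n" using i0 w(2) by (metis index_vec index_zero_vec(1))
    ultimately show ?thesis using A
      by (auto simp: spectrum_def eigenvalue_def eigenvector_def intro!: exI[of _ "vec n w"])
  qed
  show ?thesis
  proof (cases "Re (v $ i0) = 0")
    case False
    have "(\<Sum>j<n. A $$ (i, j) * Re (v $ j)) = Re k * Re (v $ i)" if "i < n" for i
      using arg_cong[OF eq[OF that], of Re] by (subst (asm) k) simp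
    then show ?thesis using eigvec[of "\<lambda>j. Re (v $ j)"] False by auto
  next
    case True
    then have "Im (v $ i0) \<noteq> 0" using i0 by (simp add: complex_eq_iff)
    moreover have "(\<Sum>j<n. A $$ (i, j) * Im (v $ j)) = Re k * Im (v $ i)" if "i < n" for i
      using arg_cong[OF eq[OF that], of Im] by (subst (asm) k) simp
    ultimately show ?thesis using eigvec[of "\<lambda>j. Im (v $ j)"] by auto
  qed
qed

text \<open>The eigenvalue equation is put on functions of the vertices, so that the list chosen by
  \<open>SOME\<close> in \<open>rho\<close> disappears from the later arguments.\<close>

definition graph_eigenvalue :: "'a pair_pre_digraph \<Rightarrow> real \<Rightarrow> bool" where
  "graph_eigenvalue G k \<longleftrightarrow>
     (\<exists>x. (\<exists>v\<in>pverts G. x v \<noteq> 0) \<and>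
          (\<forall>u\<in>pverts G. (\<Sum>v | v \<in> pverts G \<and> (u, v) \<in> parcs G. x v) = k * x u))"

lemma spectrum_adjacency_matrix_iff:
  assumes "distinct vs" "set vs = pverts G"
  shows "k \<in> spectrum (adjacency_matrix vs G) \<longleftrightarrow> graph_eigenvalue G k"
proof -
  let ?A = "adjacency_matrix vs G" and ?n = "length vs"
  have A: "?A \<in> carrier_mat ?n ?n" by (simp add: adjacency_matrix_def)
  have bij: "bij_betw ((!) vs) {..<?n} (pverts G)"
    using assms bij_betw_nth by blast
  have mult: "(?A *\<^sub>v w) $ i = (\<Sum>v | v \<in> pverts G \<and> (vs ! i, v) \<in> parcs G. x v)"
    if "i < ?n" "w \<in> carrier_vec ?n" "\<And>j. j < ?n \<Longrightarrow> w $ j = x (vs ! j)" for i w x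
  proof -
    have "(?A *\<^sub>v w) $ i = (\<Sum>j<?n. if (vs ! i, vs ! j) \<in> parcs G then x (vs ! j) else 0)"
      using that by (auto simp: adjacency_matrix_def scalar_prod_def atLeast0LessThan intro!: sum.cong)
    also have "\<dots> = (\<Sum>v\<in>pverts G. if (vs ! i, v) \<in> parcs G then x v else 0)"
      by (rule sum.reindex_bij_betw[OF bij])
    also have "\<dots> = (\<Sum>v | v \<in> pverts G \<and> (vs ! i, v) \<in> parcs G. x v)"
      using assms(2) by (subst sum.inter_filter) (auto simp flip: assms(2))
    finally show ?thesis .
  qed
  show ?thesis
  proof
    assume "k \<in> spectrum ?A"
    then obtain w where w: "w \<in> carrier_vec ?n" "w \<noteq> 0\<^sub>v ?n" "?A *\<^sub>v w = k \<cdot>\<^sub>v w"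
      using A by (auto simp: spectrum_def eigenvalue_def eigenvector_def)
    define x where "x v = w $ (the_inv_into {..<?n} ((!) vs) v)" for v
    have x: "w $ j = x (vs ! j)" if "j < ?n" for j
      using that bij by (simp add: x_def the_inv_into_f_f bij_betw_imp_inj_on)
    obtain i0 where "i0 < ?n" "w $ i0 \<noteq> 0" using w(1,2) by (auto simp: vec_eq_iff)
    then have "\<exists>v\<in>pverts G. x v \<noteq> 0" using x assms(2) nth_mem by metis
    moreover have "(\<Sum>v | v \<in> pverts G \<and> (u, v) \<in> parcs G. x v) = k * x u"
      if "u \<in> pverts G" for u
    proof -
      obtain i where i: "i < ?n" "u = vs ! i" using \<open>u \<in> pverts G\<close> assms(2) by (metis in_set_conv_nth)
      show ?thesis using mult[OF i(1) w(1) x] w(1,3) i x by simp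
    qed
    ultimately show "graph_eigenvalue G k" unfolding graph_eigenvalue_def by blast
  next
    assume "graph_eigenvalue G k"
    then obtain x v0 where x: "v0 \<in> pverts G" "x v0 \<noteq> 0"
      "\<And>u. u \<in> pverts G \<Longrightarrow> (\<Sum>v | v \<in> pverts G \<and> (u, v) \<in> parcs G. x v) = k * x u"
      unfolding graph_eigenvalue_def by blast
    define w where "w = vec ?n (\<lambda>j. x (vs ! j))"
    obtain i0 where i0: "i0 < ?n" "v0 = vs ! i0" using x(1) assms(2) by (metis in_set_conv_nth)
    have "w $ i0 \<noteq> 0" using i0 x(2) by (simp add: w_def)
    then have "w \<noteq> 0\<^sub>v ?n" using i0 by auto
    moreover have "?A *\<^sub>v w = k \<cdot>\<^sub>v w"
    proof (rule eq_vecI)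
      fix i assume "i < dim_vec (k \<cdot>\<^sub>v w)"
      then have i: "i < ?n" by (simp add: w_def)
      have vsi: "vs ! i \<in> pverts G" using i nth_mem unfolding assms(2)[symmetric] by blast
      have "(?A *\<^sub>v w) $ i = k * x (vs ! i)"
        using mult[of i w x] x(3)[OF vsi] i by (simp add: w_def)
      then show "(?A *\<^sub>v w) $ i = (k \<cdot>\<^sub>v w) $ i"
        using i by (simp add: w_def)
    qed (simp add: w_def adjacency_matrix_def)
    ultimately show "k \<in> spectrum ?A" using A
      by (auto simp: spectrum_def eigenvalue_def eigenvector_def w_def intro!: exI[of _ w])
  qed
qed

lemma finite_graph_eigenvalues:
  assumes "finite (pverts G)"
  shows "finite {k. graph_eigenvalue G k}"
proof -
  obtain vs where vs: "distinct vs" "set vs = pverts G"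
    using finite_distinct_list[OF assms] by blast
  have "{k. graph_eigenvalue G k} = spectrum (adjacency_matrix vs G)"
    using spectrum_adjacency_matrix_iff[OF vs] by auto
  then show ?thesis
    using card_finite_spectrum(1)[of "adjacency_matrix vs G" "length vs"]
    by (simp add: adjacency_matrix_def)
qed

lemma rho_eq_Max:
  assumes "finite (pverts G)"
  shows "rho G = Max {k. graph_eigenvalue G k}"
proof -
  let ?vs = "SOME vs. distinct vs \<and> set vs = pverts G"
  have "distinct ?vs \<and> set ?vs = pverts G"
    by (rule someI_ex) (use finite_distinct_list[OF assms] in blast)
  then have "spectrum (adjacency_matrix ?vs G) = {k. graph_eigenvalue G k}"
    using spectrum_adjacency_matrix_iff[of ?vs G] by blast
  then show ?thesis by (simp add: rho_def)
qed

lemma graph_eigenvalue_le_rho: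
  "finite (pverts G) \<Longrightarrow> graph_eigenvalue G k \<Longrightarrow> k \<le> rho G"
  by (simp add: rho_eq_Max finite_graph_eigenvalues)

lemma graph_eigenvalue_rho:
  assumes G: "pair_graph G" and ne: "pverts G \<noteq> {}"
  shows "graph_eigenvalue G (rho G)"
proof -
  interpret pair_graph G by fact
  obtain vs where vs: "distinct vs" "set vs = pverts G"
    using finite_distinct_list[OF pair_finite_verts] by blast
  have "(u, v) \<in> parcs G \<longleftrightarrow> (v, u) \<in> parcs G" for u v
    using pair_sym_arcs by (auto simp: symmetric_def dest: symD)
  then have "spectrum (adjacency_matrix vs G) \<noteq> {}"
    using vs ne
    by (intro real_symmetric_spectrum_nonempty[of _ "length vs"]) (auto simp: adjacency_matrix_def)
  then have "{k. graph_eigenvalue G k} \<noteq> {}"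
    using spectrum_adjacency_matrix_iff[OF vs] by auto
  then show ?thesis
    using Max_in[OF finite_graph_eigenvalues[OF pair_finite_verts]]
    by (simp add: rho_eq_Max pair_finite_verts)
qed

section \<open>Bad pairs of edges\<close>

text \<open>A tree that joins each vertex other than the root to a neighbour nearer to the root has
  \<open>card V - 1\<close> edges, and each of them gives two arcs of a symmetric relation.\<close>

lemma card_connected_symmetric_relation_ge:
  assumes V: "finite V" and R: "R \<subseteq> V \<times> V" "sym R"
    and conn: "\<And>v. v \<in> V \<Longrightarrow> (r, v) \<in> R\<^sup>*" and "r \<in> V"
  shows "2 * (card V - 1) \<le> card R"
proof -
  define d where "d v = (LEAST n. (r, v) \<in> R ^^ n)" for v
  have reach: "(r, v) \<in> R ^^ d v" if "v \<in> V" for v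
    unfolding d_def using conn[OF that, unfolded rtrancl_power] by (rule LeastI_ex)
  have "\<exists>u. (u, v) \<in> R \<and> d u < d v" if "v \<in> V - {r}" for v
  proof -
    have "d v \<noteq> 0"
    proof
      assume "d v = 0"
      with reach[of v] that show False by simp
    qed
    then obtain k where k: "d v = Suc k" using not0_implies_Suc by blast
    have "(r, v) \<in> R ^^ Suc k" using reach[of v] that k by simp
    then obtain u where u: "(r, u) \<in> R ^^ k" "(u, v) \<in> R" by (rule relpow_Suc_E)
    have "d u \<le> k" unfolding d_def using u(1) by (rule Least_le)
    then show ?thesis using u k by auto
  qed
  then have "\<exists>par. \<forall>v\<in>V - {r}. (par v, v) \<in> R \<and> d (par v) < d v" by (intro bchoice) blast
  then obtain par where par: "\<And>v. v \<in> V - {r} \<Longrightarrow> (par v, v) \<in> R \<and> d (par v) < d v" by blast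
  let ?S = "(\<lambda>v. (par v, v)) ` (V - {r})"
  have fin: "finite R" using R V finite_subset by blast
  have inj: "inj_on (\<lambda>v. (par v, v)) (V - {r})" by (rule inj_onI) simp
  have S: "card ?S = card V - 1"
    using V \<open>r \<in> V\<close> by (simp add: card_image[OF inj])
  have "finite ?S" using V by simp
  \<comment> \<open>An arc in both sets would join two vertices each of which is strictly nearer to
    \<open>r\<close> than the other.\<close>
  have "?S \<inter> ?S\<inverse> = {}"
  proof -
    have False if "x \<in> ?S" "x \<in> ?S\<inverse>" for x
    proof -
      obtain v w where "v \<in> V - {r}" "w \<in> V - {r}" "par v = w" "par w = v"
        using \<open>x \<in> ?S\<close> \<open>x \<in> ?S\<inverse>\<close> by auto
      then show False using par[of v] par[of w] by simp
    qed
    then show ?thesis by blast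
  qed
  then have "card (?S \<union> ?S\<inverse>) = 2 * (card V - 1)"
    using \<open>finite ?S\<close> S by (subst card_Un_disjoint) (simp_all add: card_inverse)
  moreover have "?S \<subseteq> R" using par by auto
  then have "?S \<union> ?S\<inverse> \<subseteq> R" using R(2) by (auto dest: symD)
  ultimately show ?thesis using card_mono[OF fin, of "?S \<union> ?S\<inverse>"] by simp
qed

text \<open>
  The number of bad pairs is twice the sum of the squared \<open>2 \<times> 2\<close> minors of the
  biadjacency matrix.
\<close>

definition bad_pairs :: "('a \<times> 'b) set \<Rightarrow> (('a \<times> 'b) \<times> ('a \<times> 'b)) set" where
  "bad_pairs E = {(f, g) \<in> E \<times> E. (fst f, snd g) \<notin> E \<or> (fst g, snd f) \<notin> E}"

lemma bad_pairsI:
  "(a, b) \<in> E \<Longrightarrow> (a', b') \<in> E \<Longrightarrow> (a, b') \<notin> E \<or> (a', b) \<notin> E \<Longrightarrow> ((a, b), (a', b')) \<in> bad_pairs E"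
  by (auto simp: bad_pairs_def)

lemma bad_pairs_subset: "bad_pairs E \<subseteq> E \<times> E"
  by (auto simp: bad_pairs_def)

lemma sym_bad_pairs: "sym (bad_pairs E)"
  by (auto simp: bad_pairs_def sym_def)

lemma finite_bad_pairs: "finite E \<Longrightarrow> finite (bad_pairs E)"
  using bad_pairs_subset finite_subset by blast

text \<open>Exchanging the two sides keeps pairs bad, so facts on rows carry over to
  columns.\<close>

lemma card_bad_pairs_converse: "card (bad_pairs (E\<inverse>)) = card (bad_pairs E)"
proof -
  have "bad_pairs (E\<inverse>) = map_prod prod.swap prod.swap ` bad_pairs E"
    by (force simp: bad_pairs_def image_iff)
  then show ?thesis by (simp add: card_image inj_on_def map_prod_def split_beta prod_eq_iff)
qed

text \<open>Without a full row, chains of bad pairs connect any two edges, so the bound for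
  connected symmetric relations applies to the set of edges.\<close>

lemma card_bad_pairs_ge_if_no_full_row:
  assumes fin: "finite A" "finite B" and E: "E \<subseteq> A \<times> B"
    and col: "\<And>b. b \<in> B \<Longrightarrow> \<exists>a. (a, b) \<in> E"
    and nofull: "\<And>a. a \<in> A \<Longrightarrow> \<exists>b\<in>B. (a, b) \<notin> E"
  shows "2 * (card E - 1) \<le> card (bad_pairs E)"
proof (cases "E = {}")
  case False
  let ?R = "(bad_pairs E)\<^sup>*"
  have finE: "finite E" using E fin finite_subset by blast
  have "(f, g) \<in> ?R" if f: "f \<in> E" and g: "g \<in> E" for f g
  proof -
    obtain a b a' b' where fg: "f = (a, b)" "g = (a', b')" by fastforce
    \<comment> \<open>Two edges in row \<open>a\<close> are both bad with any edge in a column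
      \<open>b0\<close> that \<open>a\<close> misses.\<close>
    have same_row: "((a, b), (a, b')) \<in> ?R" if ab: "(a, b) \<in> E" "(a, b') \<in> E" for a b b'
    proof -
      obtain b0 where b0: "b0 \<in> B" "(a, b0) \<notin> E" using nofull ab E by blast
      then obtain a0 where a0: "(a0, b0) \<in> E" using col by blast
      have "((a, b), (a0, b0)) \<in> bad_pairs E" "((a0, b0), (a, b')) \<in> bad_pairs E"
        using ab a0 b0 by (auto intro!: bad_pairsI)
      then show ?thesis by (meson converse_rtrancl_into_rtrancl rtrancl.rtrancl_refl)
    qed
    obtain b0 where b0: "b0 \<in> B" "(a, b0) \<notin> E" using nofull f fg E by blast
    \<comment> \<open>An edge \<open>(a', b0)\<close> is bad with \<open>(a, b)\<close> and shares
      its row with \<open>(a', b')\<close>; if it is absent, any edge in column \<open>b0\<close> is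
      bad with both.\<close>
    show ?thesis
    proof (cases "(a', b0) \<in> E")
      case True
      have "((a, b), (a', b0)) \<in> bad_pairs E" using True b0 f fg by (auto intro!: bad_pairsI)
      then show ?thesis using same_row[OF True] g fg by (meson converse_rtrancl_into_rtrancl)
    next
      case False
      obtain a0 where a0: "(a0, b0) \<in> E" using col b0 by blast
      have "((a, b), (a0, b0)) \<in> bad_pairs E" "((a0, b0), (a', b')) \<in> bad_pairs E"
        using f g fg a0 b0 False by (auto intro!: bad_pairsI)
      then show ?thesis using fg by (meson converse_rtrancl_into_rtrancl rtrancl.rtrancl_refl)
    qed
  qed
  moreover obtain f where "f \<in> E" using False by blast
  ultimately show ?thesis
    by (intro card_connected_symmetric_relation_ge[OF finE bad_pairs_subset sym_bad_pairs, of f])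
qed simp

lemma card_bad_pairs_ge_if_no_full_column:
  assumes "finite A" "finite B" "E \<subseteq> A \<times> B"
    and "\<And>a. a \<in> A \<Longrightarrow> \<exists>b. (a, b) \<in> E"
    and "\<And>b. b \<in> B \<Longrightarrow> \<exists>a\<in>A. (a, b) \<notin> E"
  shows "2 * (card E - 1) \<le> card (bad_pairs E)"
  using card_bad_pairs_ge_if_no_full_row[of B A "E\<inverse>"] assms
  by (fastforce simp: card_bad_pairs_converse card_inverse)

section \<open>Structure of bipartite graphs with few bad pairs\<close>

text \<open>The left side will be the number of edges; the right side will be 2 more than half the
  number of bad pairs exhibited. Here \<open>\<alpha>\<close> and \<open>\<beta>\<close> count full
  rows and columns, the remaining \<open>p\<close> by \<open>q\<close> block has \<open>n\<close>
  non-edges and \<open>m\<close> edges, and \<open>X\<close> and \<open>Y\<close> count the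
  combinations of a non-edge and an edge of that block in a common row or column.\<close>

lemma bad_pairs_count_arith:
  fixes \<alpha> \<beta> p q m n X Y :: nat
  assumes pos: "\<alpha> \<ge> 1" "\<beta> \<ge> 1" "p \<ge> 2" "q \<ge> 2" "m \<ge> 1"
    and nm: "n + m = p * q" "n \<ge> p" "n \<ge> q"
    and X: "X \<ge> m" "X + 1 \<ge> q" and Y: "Y \<ge> m" "Y + 1 \<ge> p"
  shows "\<alpha> * \<beta> + \<alpha> * q + \<beta> * p + m \<le> \<alpha> * \<beta> * n + \<alpha> * X + \<beta> * Y + 2"
proof -
  \<comment> \<open>For \<open>m \<ge> 2\<close> the larger of \<open>\<alpha>\<close> and
    \<open>\<beta>\<close> plays the role of \<open>a\<close>; the two cases differ by exchanging
    the sides.\<close>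
  have big: "a * b + a * q + b * p + m \<le> a * b * n + a * X + b * Y + 2"
    if ab: "b \<le> a" "1 \<le> b" and m: "2 \<le> m" and n: "q \<le> n" and X: "m \<le> X" and Y: "p \<le> Y + 1"
      and q: "1 \<le> q" for a b p q n X Y :: int and m :: int
  proof -
    have "a * (q - 1) \<le> a * (n - 1)" using ab n by (intro mult_left_mono) auto
    also have "\<dots> \<le> b * (a * (n - 1))"
      using mult_right_mono[of 1 b "a * (n - 1)"] ab n q by simp
    finally have 1: "a * q - a \<le> a * b * n - a * b" by (simp add: algebra_simps)
    have 2: "a * m \<le> a * X" using ab X by (intro mult_left_mono) auto
    have 3: "b * p - b \<le> b * Y" using ab Y mult_left_mono[of "p - 1" Y b] by (simp add: algebra_simps)
    \<comment> \<open>Together with \<open>b \<le> a\<close> this gives a + b + m \<le> a m + 2,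
      which pays for the terms \<open>a\<close> and \<open>b\<close> lost in \<open>1\<close> and
      \<open>3\<close>.\<close>
    have 4: "a - 1 \<le> a * m - a - m + 1"
      using ab m mult_left_mono[of 1 "m - 1" "a - 1"] by (simp add: algebra_simps)
    show ?thesis using 1 2 3 4 ab by linarith
  qed
  consider "m = 1" | "m \<ge> 2" "\<beta> \<le> \<alpha>" | "m \<ge> 2" "\<alpha> \<le> \<beta>" using pos by linarith
  then show ?thesis
  proof cases
    case 1
    \<comment> \<open>Now n = p q - 1 \<ge> 3, so \<open>\<alpha> * \<beta> * n\<close> covers
      \<open>\<alpha> * \<beta> + \<alpha> + \<beta>\<close>; the last two summands make up for the
      1 in \<open>X + 1 \<ge> q\<close> and \<open>Y + 1 \<ge> p\<close>.\<close>
    have "2 * 2 \<le> p * q" using pos by (intro mult_le_mono) auto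
    then have n: "n = (n - 3) + 3" using nm(1) 1 by simp
    have "\<alpha> \<le> \<alpha> * \<beta>" "\<beta> \<le> \<alpha> * \<beta>" using pos by simp_all
    moreover have "\<alpha> * \<beta> * n = \<alpha> * \<beta> * (n - 3) + 3 * (\<alpha> * \<beta>)" by (subst n) (simp add: algebra_simps)
    moreover have "\<alpha> * q \<le> \<alpha> * X + \<alpha>" using X(2) mult_le_mono2[of q "X + 1" \<alpha>] by simp
    moreover have "\<beta> * p \<le> \<beta> * Y + \<beta>" using Y(2) mult_le_mono2[of p "Y + 1" \<beta>] by simp
    ultimately show ?thesis using 1 by linarith
  next
    case 2
    have "int (\<alpha> * \<beta> + \<alpha> * q + \<beta> * p + m) \<le> int (\<alpha> * \<beta> * n + \<alpha> * X + \<beta> * Y + 2)"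
      using big[of "int \<beta>" "int \<alpha>" "int m" "int q" "int n" "int X" "int p" "int Y"] 2 pos nm X Y by simp
    then show ?thesis by (simp only: of_nat_le_iff)
  next
    case 3
    have "int (\<alpha> * \<beta> + \<alpha> * q + \<beta> * p + m) \<le> int (\<alpha> * \<beta> * n + \<alpha> * X + \<beta> * Y + 2)"
      using big[of "int \<alpha>" "int \<beta>" "int m" "int p" "int n" "int Y" "int q" "int X"] 3 pos nm X Y
      by (simp add: ac_simps)
    then show ?thesis by (simp only: of_nat_le_iff)
  qed
qed

text \<open>\<open>A'\<close> and \<open>B'\<close> collect the rows and columns with a missing
  entry. Few bad pairs force full rows and full columns to exist; a single edge inside
  \<open>A' \<times> B'\<close> would then create at least 2 (e - 2) bad pairs, e being the number
  of edges, so all of \<open>A' \<times> B'\<close> is missing.\<close>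

lemma nearly_complete_bipartite_if_few_bad_pairs:
  fixes A :: "'a set" and B :: "'b set"
  assumes fin: "finite A" "finite B" and E: "E \<subseteq> A \<times> B"
    and row: "\<And>a. a \<in> A \<Longrightarrow> \<exists>b. (a, b) \<in> E" and col: "\<And>b. b \<in> B \<Longrightarrow> \<exists>a. (a, b) \<in> E"
    and ne: "E \<noteq> A \<times> B" and few: "card (bad_pairs E) + 6 \<le> 2 * card E"
  obtains A' B' where "A' \<subset> A" "B' \<subset> B" "A' \<noteq> {}" "B' \<noteq> {}" "E = A \<times> B - A' \<times> B'"
    "2 * (card (A - A') * card (B - B') * card A' * card B') \<le> card (bad_pairs E)"
proof -
  define A' where "A' = {a\<in>A. \<exists>b\<in>B. (a, b) \<notin> E}"
  define B' where "B' = {b\<in>B. \<exists>a\<in>A. (a, b) \<notin> E}"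
  define A0 where "A0 = A - A'"
  define B0 where "B0 = B - B'"
  define N where "N = A' \<times> B' - E"
  define M where "M = A' \<times> B' \<inter> E"
  \<comment> \<open>A triple in \<open>XS\<close> with a full row, or one in \<open>YS\<close> with
    a full column, spans a rectangle: the non-edge of the triple is its missing corner, and the edge
    in \<open>M\<close> and the corner opposite to it form a bad pair.\<close>
  define XS where "XS = {(a, b, b'). (a, b) \<in> N \<and> (a, b') \<in> M}"
  define YS where "YS = {(a, a', b). (a, b) \<in> N \<and> (a', b) \<in> M}"
  have full: "(a, b) \<in> E" if "a \<in> A" "b \<in> B" "a \<in> A0 \<or> b \<in> B0" for a b
    using that by (auto simp: A0_def B0_def A'_def B'_def)
  have sub: "A' \<subseteq> A" "B' \<subseteq> B" "A0 \<subseteq> A" "B0 \<subseteq> B" by (auto simp: A'_def B'_def A0_def B0_def)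
  have disj: "A0 \<inter> A' = {}" "B0 \<inter> B' = {}" by (auto simp: A0_def B0_def)
  have finAB: "finite A'" "finite B'" "finite A0" "finite B0" using sub fin finite_subset by blast+
  have finNM: "finite N" "finite M" using finAB by (auto simp: N_def M_def)
  have finX: "finite XS" by (rule finite_subset[of _ "A' \<times> B' \<times> B'"]) (use finAB in \<open>auto simp: XS_def N_def M_def\<close>)
  have finY: "finite YS" by (rule finite_subset[of _ "A' \<times> A' \<times> B'"]) (use finAB in \<open>auto simp: YS_def N_def M_def\<close>)
  have finE: "finite E" using E fin finite_subset by blast
  have "A0 \<noteq> {}"
  proof
    assume "A0 = {}"
    then have "2 * (card E - 1) \<le> card (bad_pairs E)"
      using fin E col sub by (intro card_bad_pairs_ge_if_no_full_row) (auto simp: A0_def A'_def)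
    then show False using few by linarith
  qed
  have "B0 \<noteq> {}"
  proof
    assume "B0 = {}"
    then have "2 * (card E - 1) \<le> card (bad_pairs E)"
      using fin E row sub by (intro card_bad_pairs_ge_if_no_full_column) (auto simp: B0_def B'_def)
    then show False using few by linarith
  qed
  obtain a0 b0 where ab0: "a0 \<in> A" "b0 \<in> B" "(a0, b0) \<notin> E" using ne E by auto
  then have ab0': "a0 \<in> A'" "b0 \<in> B'" by (auto simp: A'_def B'_def)
  have E_eq: "E = A0 \<times> B0 \<union> A0 \<times> B' \<union> A' \<times> B0 \<union> M"
    using E sub by (auto simp: M_def A0_def B0_def A'_def B'_def)
  have cardE: "card E = card A0 * card B0 + card A0 * card B' + card B0 * card A' + card M"
  proof -
    have 1: "card (A0 \<times> B0 \<union> A0 \<times> B') = card A0 * card B0 + card A0 * card B'"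
      using finAB disj by (subst card_Un_disjoint) (auto simp: card_cartesian_product)
    have 2: "card (A0 \<times> B0 \<union> A0 \<times> B' \<union> A' \<times> B0) = card A0 * card B0 + card A0 * card B' + card B0 * card A'"
      using finAB disj by (subst card_Un_disjoint) (auto simp: card_cartesian_product 1)
    show ?thesis
      by (subst E_eq, subst card_Un_disjoint) (use finAB finNM disj in \<open>auto simp: 2 M_def\<close>)
  qed
  \<comment> \<open>The edges incident to \<open>A0\<close> or \<open>B0\<close> already lie in enough bad pairs.\<close>
  define P1 where "P1 = (\<lambda>(a', b', a, b). ((a', b), (a, b'))) ` (A0 \<times> B0 \<times> N)"
  define P2 where "P2 = (\<lambda>(a', a, b, b'). ((a', b), (a, b'))) ` (A0 \<times> XS)"
  define P3 where "P3 = (\<lambda>(b', a, a', b). ((a, b'), (a', b))) ` (B0 \<times> YS)"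
  have P1: "card P1 = card A0 * card B0 * card N"
    unfolding P1_def by (subst card_image) (auto simp: inj_on_def card_cartesian_product)
  have P2: "card P2 = card A0 * card XS"
    unfolding P2_def by (subst card_image) (auto simp: inj_on_def card_cartesian_product)
  have P3: "card P3 = card B0 * card YS"
    unfolding P3_def by (subst card_image) (auto simp: inj_on_def card_cartesian_product)
  \<comment> \<open>The blocks that contain the two edges separate the three families from each
    other and from their converses, so the counts add up and double.\<close>
  have types: "P1 \<subseteq> (A0 \<times> B') \<times> (A' \<times> B0)" "P2 \<subseteq> (A0 \<times> B') \<times> (A' \<times> B')"
    "P3 \<subseteq> (A' \<times> B0) \<times> (A' \<times> B')"
    by (auto simp: P1_def P2_def P3_def XS_def YS_def N_def M_def)
  have finP: "finite P1" "finite P2" "finite P3"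
    using finAB finNM finX finY by (auto simp: P1_def P2_def P3_def)
  let ?P = "P1 \<union> (P2 \<union> P3)"
  have "card ?P = card P1 + (card P2 + card P3)"
  proof -
    have "P2 \<inter> P3 = {}" using types disj by blast
    moreover have "P1 \<inter> (P2 \<union> P3) = {}" using types disj by blast
    ultimately show ?thesis using finP by (simp add: card_Un_disjoint)
  qed
  moreover have "card (?P \<union> ?P\<inverse>) = 2 * card ?P"
  proof -
    have "?P \<inter> ?P\<inverse> = {}" using types disj by blast
    then show ?thesis using finP by (subst card_Un_disjoint) (simp_all add: card_inverse)
  qed
  moreover have "?P \<union> ?P\<inverse> \<subseteq> bad_pairs E"
  proof -
    have "?P \<subseteq> bad_pairs E"
      using sub by (auto simp: P1_def P2_def P3_def XS_def YS_def N_def M_def bad_pairs_def intro: full)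
    then show ?thesis using sym_bad_pairs[of E] by (auto dest: symD)
  qed
  ultimately have D: "2 * (card A0 * card B0 * card N + card A0 * card XS + card B0 * card YS) \<le> card (bad_pairs E)"
    using card_mono[OF finite_bad_pairs[OF finE], of "?P \<union> ?P\<inverse>"] P1 P2 P3 by simp
  have "M = {}"
  proof (rule ccontr)
    assume "M \<noteq> {}"
    then obtain a1 b1 where ab1: "(a1, b1) \<in> M" by auto
    have rowN: "\<exists>b. (a, b) \<in> N" if "a \<in> A'" for a
      using that by (auto simp: N_def A'_def B'_def)
    have colN: "\<exists>a. (a, b) \<in> N" if "b \<in> B'" for b
      using that by (auto simp: N_def A'_def B'_def)
    obtain b2 where b2: "(a1, b2) \<in> N" using rowN ab1 by (auto simp: M_def)
    obtain a2 where a2: "(a2, b1) \<in> N" using colN ab1 by (auto simp: M_def)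
    have "b1 \<noteq> b2" "a1 \<noteq> a2" using ab1 a2 b2 by (auto simp: N_def M_def)
    have "card {a1, a2} \<le> card A'" "card {b1, b2} \<le> card B'"
      using ab1 a2 b2 finAB by (intro card_mono; auto simp: N_def M_def)+
    then have ge2: "card A' \<ge> 2" "card B' \<ge> 2" using \<open>b1 \<noteq> b2\<close> \<open>a1 \<noteq> a2\<close> by auto
    have m: "card M \<ge> 1" using ab1 finNM by (simp add: Suc_le_eq card_gt_0_iff) blast
    have "card (N \<union> M) = card N + card M"
      using finNM by (intro card_Un_disjoint) (auto simp: N_def M_def)
    moreover have "N \<union> M = A' \<times> B'" by (auto simp: N_def M_def)
    ultimately have nm: "card N + card M = card A' * card B'" by (simp add: card_cartesian_product)
    have "A' \<subseteq> fst ` N" using rowN by force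
    then have np: "card N \<ge> card A'" using finNM surj_card_le by blast
    have "B' \<subseteq> snd ` N" using colN by force
    then have nq: "card N \<ge> card B'" using finNM surj_card_le by blast
    have "M \<subseteq> (\<lambda>(a, b, b'). (a, b')) ` XS"
    proof
      fix z assume "z \<in> M"
      then obtain a b' where "z = (a, b')" "(a, b') \<in> M" "a \<in> A'" by (auto simp: M_def)
      moreover from this obtain b where "(a, b) \<in> N" using rowN by blast
      ultimately show "z \<in> (\<lambda>(a, b, b'). (a, b')) ` XS"
        by (intro image_eqI[of _ _ "(a, b, b')"]) (auto simp: XS_def)
    qed
    then have Xm: "card XS \<ge> card M" using finX surj_card_le by blast
    have "M \<subseteq> (\<lambda>(a, a', b). (a', b)) ` YS"
    proof
      fix z assume "z \<in> M"
      then obtain a' b where "z = (a', b)" "(a', b) \<in> M" "b \<in> B'" by (auto simp: M_def)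
      moreover from this obtain a where "(a, b) \<in> N" using colN by blast
      ultimately show "z \<in> (\<lambda>(a, a', b). (a', b)) ` YS"
        by (intro image_eqI[of _ _ "(a, a', b)"]) (auto simp: YS_def)
    qed
    then have Ym: "card YS \<ge> card M" using finY surj_card_le by blast
    \<comment> \<open>Row \<open>a1\<close> has an edge at \<open>b1\<close> and a non-edge at
      \<open>b2\<close>: every edge of the row is combined with \<open>b2\<close>, every other
      non-edge with \<open>b1\<close>. Columns \<open>b1\<close> and \<open>b2\<close> would give
      the same triple, so \<open>b2\<close> is left out, which costs 1.\<close>
    have "card (B' - {b2}) \<le> card XS"
    proof (rule card_inj_on_le[OF _ _ finX])
      let ?h = "\<lambda>b. if (a1, b) \<in> M then (a1, b2, b) else (a1, b, b1)"
      show "inj_on ?h (B' - {b2})" by (auto simp: inj_on_def split: if_splits)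
      show "?h ` (B' - {b2}) \<subseteq> XS" using ab1 b2 by (auto simp: XS_def N_def M_def)
    qed
    then have Xq: "card XS + 1 \<ge> card B'" using b2 finAB by (simp add: N_def card_Diff_singleton)
    have "card (A' - {a2}) \<le> card YS"
    proof (rule card_inj_on_le[OF _ _ finY])
      let ?h = "\<lambda>a. if (a, b1) \<in> M then (a2, a, b1) else (a, a1, b1)"
      show "inj_on ?h (A' - {a2})" by (auto simp: inj_on_def split: if_splits)
      show "?h ` (A' - {a2}) \<subseteq> YS" using ab1 a2 by (auto simp: YS_def N_def M_def)
    qed
    then have Yp: "card YS + 1 \<ge> card A'" using a2 finAB by (simp add: N_def card_Diff_singleton)
    have pos: "card A0 \<ge> 1" "card B0 \<ge> 1"
      using \<open>A0 \<noteq> {}\<close> \<open>B0 \<noteq> {}\<close> finAB by (simp_all add: Suc_le_eq card_gt_0_iff)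
    have "card E \<le> card A0 * card B0 * card N + card A0 * card XS + card B0 * card YS + 2"
      unfolding cardE by (rule bad_pairs_count_arith[OF pos ge2 m nm np nq Xm Xq Ym Yp])
    with D few show False by (simp only: distrib_left)
  qed
  show ?thesis
  proof (rule that[of A' B'])
    show "A' \<subset> A" "B' \<subset> B" using sub \<open>A0 \<noteq> {}\<close> \<open>B0 \<noteq> {}\<close> by (auto simp: A0_def B0_def)
    show "A' \<noteq> {}" "B' \<noteq> {}" using ab0' by auto
    show "E = A \<times> B - A' \<times> B'" using E_eq \<open>M = {}\<close> sub by (auto simp: A0_def B0_def)
    have "N = A' \<times> B'" using \<open>M = {}\<close> by (auto simp: N_def M_def)
    then have "card N = card A' * card B'" by (simp add: card_cartesian_product)
    then show "2 * (card (A - A') * card (B - B') * card A' * card B') \<le> card (bad_pairs E)"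
      using D by (simp add: A0_def B0_def mult.assoc)
  qed
qed

section \<open>Spectral bounds for bipartite graphs\<close>

definition bipartition :: "'a pair_pre_digraph \<Rightarrow> 'a set \<Rightarrow> 'a set \<Rightarrow> bool" where
  "bipartition G A B \<longleftrightarrow> pverts G = A \<union> B \<and> A \<inter> B = {} \<and> parcs G \<subseteq> A \<times> B \<union> B \<times> A"

text \<open>Each undirected edge is kept once, directed from \<open>A\<close> to \<open>B\<close>.
  This is the biadjacency matrix as a relation, the form to which \<open>bad_pairs\<close>
  applies.\<close>

definition arcs_between :: "'a pair_pre_digraph \<Rightarrow> 'a set \<Rightarrow> 'a set \<Rightarrow> ('a \<times> 'a) set" where
  "arcs_between G A B = parcs G \<inter> A \<times> B"

lemma bipartite_iff_bipartition: "bipartite G \<longleftrightarrow> (\<exists>A B. bipartition G A B)"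
  by (simp add: bipartite_def bipartition_def)

lemma bipartition_commute: "bipartition G A B \<Longrightarrow> bipartition G B A"
  by (auto simp: bipartition_def)

lemma parcs_sym: "pair_graph G \<Longrightarrow> (u, v) \<in> parcs G \<longleftrightarrow> (v, u) \<in> parcs G"
  using pair_sym_digraph.pair_sym_arcs[of G] unfolding pair_graph_def pair_pseudo_graph_def
  by (auto simp: symmetric_def dest: symD)

lemma finite_pverts: "pair_graph G \<Longrightarrow> finite (pverts G)"
  using pair_fin_digraph.pair_finite_verts unfolding pair_graph_def pair_pseudo_graph_def by blast

lemma parcs_subset: "pair_graph G \<Longrightarrow> parcs G \<subseteq> pverts G \<times> pverts G"
  using pair_wf_digraph.in_arcsD1[of G] pair_wf_digraph.in_arcsD2[of G]
  unfolding pair_graph_def pair_digraph_def pair_fin_digraph_def by auto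

lemma card_edges_eq:
  assumes G: "pair_graph G" and AB: "bipartition G A B"
  shows "card (edges G) = card (arcs_between G A B)"
proof -
  have "edges G = (\<lambda>(u, v). {u, v}) ` arcs_between G A B"
  proof
    show "edges G \<subseteq> (\<lambda>(u, v). {u, v}) ` arcs_between G A B"
    proof
      fix d assume "d \<in> edges G"
      then obtain u v where uv: "(u, v) \<in> parcs G" "d = {u, v}" by (auto simp: edges_def)
      then have "(u, v) \<in> arcs_between G A B \<or> (v, u) \<in> arcs_between G A B"
        using AB parcs_sym[OF G] unfolding bipartition_def arcs_between_def by auto
      then show "d \<in> (\<lambda>(u, v). {u, v}) ` arcs_between G A B" using uv(2) by (force simp: insert_commute)
    qed
  qed (auto simp: edges_def arcs_between_def)
  moreover have "inj_on (\<lambda>(u, v). {u, v}) (arcs_between G A B)"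
    using AB by (auto simp: inj_on_def bipartition_def arcs_between_def doubleton_eq_iff)
  ultimately show ?thesis by (simp add: card_image)
qed

lemma real_card_eq_sum_of_bool:
  assumes "finite U" "S \<subseteq> U"
  shows "real (card S) = (\<Sum>x\<in>U. of_bool (x \<in> S))"
  using assms by (simp add: of_bool_def sum.If_cases Int_absorb1 inf.absorb2)

text \<open>The inner sums are the entries of the biadjacency matrix times its transpose. Expanding
  their squares counts the rectangles with all four corners in \<open>E\<close>, that is, the pairs
  of edges that are not bad.\<close>

lemma card_good_pairs:
  assumes fin: "finite A" "finite B" and E: "E \<subseteq> A \<times> B"
  shows "(real (card E))\<^sup>2 - real (card (bad_pairs E)) =
    (\<Sum>a\<in>A. \<Sum>a'\<in>A. (\<Sum>b\<in>B. of_bool ((a, b) \<in> E) * of_bool ((a', b) \<in> E))\<^sup>2)"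
proof -
  have finE: "finite E" using E fin finite_subset by blast
  let ?good = "E \<times> E - bad_pairs E" and ?I = "\<lambda>a b. of_bool ((a, b) \<in> E) :: real"
  have "real (card ?good) = (\<Sum>x\<in>(A \<times> B) \<times> (A \<times> B). of_bool (x \<in> ?good))"
    using fin E by (intro real_card_eq_sum_of_bool) auto
  also have "\<dots> = (\<Sum>a\<in>A. \<Sum>b\<in>B. \<Sum>a'\<in>A. \<Sum>b'\<in>B. of_bool (((a, b), (a', b')) \<in> ?good))"
    by (simp only: sum.cartesian_product')
  also have "\<dots> = (\<Sum>a\<in>A. \<Sum>b\<in>B. \<Sum>a'\<in>A. \<Sum>b'\<in>B. (?I a b * ?I a' b) * (?I a b' * ?I a' b'))"
    by (intro sum.cong) (auto simp: bad_pairs_def)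
  also have "\<dots> = (\<Sum>a\<in>A. \<Sum>a'\<in>A. (\<Sum>b\<in>B. ?I a b * ?I a' b)\<^sup>2)"
    by (subst sum.swap) (simp add: power2_eq_square sum_product)
  finally have "real (card ?good) = (\<Sum>a\<in>A. \<Sum>a'\<in>A. (\<Sum>b\<in>B. ?I a b * ?I a' b)\<^sup>2)" .
  moreover have "real (card ?good) = (real (card E))\<^sup>2 - real (card (bad_pairs E))"
    using finE bad_pairs_subset[of E] card_mono[OF _ bad_pairs_subset[of E]]
    by (simp add: card_Diff_subset finite_bad_pairs card_cartesian_product of_nat_diff power2_eq_square)
  ultimately show ?thesis by simp
qed

text \<open>For \<open>k \<noteq> 0\<close>, the restriction of the eigenvector to \<open>A\<close>
  is an eigenvector of the Gram matrix \<open>M\<close> of the rows for \<open>k\<^sup>2\<close>;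
  Cauchy-Schwarz in each row bounds \<open>k ^ 4\<close> by the squared Frobenius norm of
  \<open>M\<close>.\<close>

lemma graph_eigenvalue_power4_le:
  assumes G: "pair_graph G" and AB: "bipartition G A B" and k: "graph_eigenvalue G k"
  shows "k ^ 4 + real (card (bad_pairs (arcs_between G A B))) \<le> (real (card (edges G)))\<^sup>2"
proof -
  define E where "E = arcs_between G A B"
  let ?I = "\<lambda>a b. of_bool ((a, b) \<in> E) :: real"
  define M where "M a a' = (\<Sum>b\<in>B. ?I a b * ?I a' b)" for a a'
  have verts: "pverts G = A \<union> B" "A \<inter> B = {}" and arcs: "parcs G \<subseteq> A \<times> B \<union> B \<times> A"
    using AB by (auto simp: bipartition_def)
  have fin: "finite A" "finite B" using finite_pverts[OF G] verts by auto
  have EAB: "E \<subseteq> A \<times> B" by (auto simp: E_def arcs_between_def)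
  have T: "(real (card (edges G)))\<^sup>2 - real (card (bad_pairs E)) = (\<Sum>a\<in>A. \<Sum>a'\<in>A. (M a a')\<^sup>2)"
    using card_good_pairs[OF fin EAB] card_edges_eq[OF G AB] by (simp add: E_def M_def)
  obtain x v0 where x: "v0 \<in> pverts G" "x v0 \<noteq> 0"
    and eig: "\<And>u. u \<in> pverts G \<Longrightarrow> (\<Sum>v | v \<in> pverts G \<and> (u, v) \<in> parcs G. x v) = k * x u"
    using k unfolding graph_eigenvalue_def by blast
  have eqA: "k * x a = (\<Sum>b\<in>B. ?I a b * x b)" if "a \<in> A" for a
  proof -
    have "{v. v \<in> pverts G \<and> (a, v) \<in> parcs G} = {b \<in> B. (a, b) \<in> E}"
      using that verts arcs by (auto simp: E_def arcs_between_def)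
    then have "k * x a = (\<Sum>b | b \<in> B \<and> (a, b) \<in> E. x b)" using eig[of a] that verts by simp
    also have "\<dots> = (\<Sum>b\<in>B. if (a, b) \<in> E then x b else 0)" by (simp add: sum.inter_filter fin)
    also have "\<dots> = (\<Sum>b\<in>B. ?I a b * x b)" by (intro sum.cong) auto
    finally show ?thesis .
  qed
  have eqB: "k * x b = (\<Sum>a\<in>A. ?I a b * x a)" if "b \<in> B" for b
  proof -
    have "{v. v \<in> pverts G \<and> (b, v) \<in> parcs G} = {a \<in> A. (a, b) \<in> E}"
      using that verts arcs parcs_sym[OF G] by (auto simp: E_def arcs_between_def)
    then have "k * x b = (\<Sum>a | a \<in> A \<and> (a, b) \<in> E. x a)" using eig[of b] that verts by simp
    also have "\<dots> = (\<Sum>a\<in>A. if (a, b) \<in> E then x a else 0)" by (simp add: sum.inter_filter fin)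
    also have "\<dots> = (\<Sum>a\<in>A. ?I a b * x a)" by (intro sum.cong) auto
    finally show ?thesis .
  qed
  have "k ^ 4 \<le> (\<Sum>a\<in>A. \<Sum>a'\<in>A. (M a a')\<^sup>2)"
  proof (cases "k = 0")
    case True
    then show ?thesis by (auto intro!: sum_nonneg)
  next
    case False
    \<comment> \<open>If \<open>x\<close> vanished on \<open>A\<close>, the equations at
      \<open>B\<close> would make it vanish there too, as \<open>k \<noteq> 0\<close>.\<close>
    have "\<exists>a\<in>A. x a \<noteq> 0"
    proof (rule ccontr)
      assume "\<not> ?thesis"
      then have "v0 \<in> B" "k * x v0 = 0" using x verts eqB[of v0] by auto
      then show False using False x by simp
    qed
    then have pos: "(\<Sum>a\<in>A. (x a)\<^sup>2) > 0"
      using fin by (metis sum_pos2 zero_le_power2 zero_less_power2)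
    have eq2: "k\<^sup>2 * x a = (\<Sum>a'\<in>A. M a a' * x a')" if "a \<in> A" for a
    proof -
      have "k\<^sup>2 * x a = (\<Sum>b\<in>B. ?I a b * (k * x b))"
        using eqA[OF that] by (simp add: power2_eq_square mult.assoc sum_distrib_left ac_simps)
      also have "\<dots> = (\<Sum>b\<in>B. \<Sum>a'\<in>A. ?I a b * ?I a' b * x a')"
        by (intro sum.cong) (simp_all only: eqB sum_distrib_left mult.assoc)
      also have "\<dots> = (\<Sum>a'\<in>A. M a a' * x a')"
        by (subst sum.swap) (simp add: M_def sum_distrib_right)
      finally show ?thesis .
    qed
    have "k ^ 4 * (\<Sum>a\<in>A. (x a)\<^sup>2) = (\<Sum>a\<in>A. (k\<^sup>2 * x a)\<^sup>2)"
      by (simp add: sum_distrib_left power_mult_distrib flip: power_mult)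
    also have "\<dots> \<le> (\<Sum>a\<in>A. (\<Sum>a'\<in>A. (M a a')\<^sup>2) * (\<Sum>a'\<in>A. (x a')\<^sup>2))"
      by (intro sum_mono) (simp only: eq2 Cauchy_Schwarz_ineq_sum)
    also have "\<dots> = (\<Sum>a\<in>A. \<Sum>a'\<in>A. (M a a')\<^sup>2) * (\<Sum>a\<in>A. (x a)\<^sup>2)"
      by (simp add: sum_distrib_right)
    finally show ?thesis using pos by simp
  qed
  then show ?thesis using T by (simp add: E_def)
qed

text \<open>The partition into \<open>A'\<close>, \<open>A - A'\<close>, \<open>B'\<close>,
  \<open>B - B'\<close> is equitable, and the condition on \<open>k\<close> is the characteristic
  equation of its quotient matrix. Empty \<open>A'\<close> and \<open>B'\<close> cover the complete
  bipartite graphs.\<close>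

lemma graph_eigenvalue_biclique_minus_biclique:
  assumes G: "pair_graph G" and AB: "bipartition G A B"
    and E: "arcs_between G A B = A \<times> B - A' \<times> B'"
    and sub: "A' \<subset> A" "B' \<subset> B"
    and k: "k > 0"
      "k ^ 4 + real (card (A - A') * card (B - B') * card A' * card B') = real (card (edges G)) * k\<^sup>2"
  shows "graph_eigenvalue G k"
proof -
  define \<alpha> \<beta> p q where "\<alpha> = real (card (A - A'))" and "\<beta> = real (card (B - B'))"
    and "p = real (card A')" and "q = real (card B')"
  have verts: "pverts G = A \<union> B" "A \<inter> B = {}" and arcs: "parcs G \<subseteq> A \<times> B \<union> B \<times> A"
    using AB by (auto simp: bipartition_def)
  have fin: "finite A" "finite B" using finite_pverts[OF G] verts by auto
  have finp: "finite A'" "finite B'" using fin sub finite_subset by blast+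
  have pos: "\<alpha> > 0" "\<beta> > 0" using sub fin by (auto simp: \<alpha>_def \<beta>_def card_gt_0_iff)
  have cA: "real (card A) = \<alpha> + p" "real (card B) = \<beta> + q"
    using sub fin card_mono[of A A'] card_mono[of B B'] finp
    by (auto simp: \<alpha>_def \<beta>_def p_def q_def card_Diff_subset)
  have "card (A' \<times> B') \<le> card (A \<times> B)" using fin sub by (intro card_mono) auto
  then have "real (card (edges G)) = (\<alpha> + p) * (\<beta> + q) - p * q"
    unfolding card_edges_eq[OF G AB] E
    using finp sub by (subst card_Diff_subset) (auto simp: card_cartesian_product of_nat_diff cA p_def q_def)
  then have e: "real (card (edges G)) = \<alpha> * \<beta> + \<alpha> * q + \<beta> * p" by (simp add: algebra_simps)
  have char: "(k\<^sup>2)\<^sup>2 + \<alpha> * \<beta> * p * q = (\<alpha> * \<beta> + \<alpha> * q + \<beta> * p) * k\<^sup>2"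
    using k(2) by (simp add: e \<alpha>_def \<beta>_def p_def q_def)
  \<comment> \<open>The eigenvector is constant on \<open>A'\<close>, \<open>A - A'\<close>, \<open>B'\<close> and \<open>B - B'\<close>; its values solve
    the resulting \<open>4 \<times> 4\<close> system.\<close>
  define x1 where "x1 = k\<^sup>2 - \<beta> * p"
  define x2 where "x2 = \<alpha> * \<beta>"
  define x where "x v = (if v \<in> A then if v \<in> A' then x2 else x1
     else if v \<in> B' then \<alpha> * x1 / k else (\<alpha> * x1 + p * x2) / k)" for v
  have nb: "{v. v \<in> pverts G \<and> (u, v) \<in> parcs G} =
      (if u \<in> A then if u \<in> A' then B - B' else B else if u \<in> B' then A - A' else A)"
    if "u \<in> pverts G" for u
  proof -
    have 1: "(a, b) \<in> parcs G \<longleftrightarrow> a \<notin> A' \<or> b \<notin> B'" if "a \<in> A" "b \<in> B" for a b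
      using that E unfolding arcs_between_def by blast
    have 2: "(b, a) \<in> parcs G \<longleftrightarrow> a \<notin> A' \<or> b \<notin> B'" if "a \<in> A" "b \<in> B" for a b
      using 1[OF that] parcs_sym[OF G] by blast
    show ?thesis using \<open>u \<in> pverts G\<close> verts arcs sub 1 2 by auto
  qed
  have sA: "sum x (A - A') = \<alpha> * x1"
    by (simp add: x_def \<alpha>_def)
  have sA': "sum x A' = p * x2"
    using sub by (simp add: x_def p_def subset_eq psubset_eq)
  have sA2: "sum x A = \<alpha> * x1 + p * x2"
    using sum.subset_diff[of A' A x] fin sub sA sA' by auto
  have nA: "v \<notin> A" if "v \<in> B" for v using that verts by auto
  have sB: "sum x (B - B') = \<beta> * ((\<alpha> * x1 + p * x2) / k)"
    by (simp add: x_def \<beta>_def nA)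
  have sB': "sum x B' = q * (\<alpha> * x1 / k)"
    using sub nA by (simp add: x_def q_def subset_eq psubset_eq)
  have sB2: "sum x B = \<beta> * ((\<alpha> * x1 + p * x2) / k) + q * (\<alpha> * x1 / k)"
    using sum.subset_diff[of B' B x] fin sub sB sB' by auto
  \<comment> \<open>\<open>eqx2\<close> is an identity by the choice of \<open>x1\<close> and
    \<open>x2\<close>; the characteristic equation is spent here.\<close>
  have eqx1: "\<beta> * (\<alpha> * x1 + p * x2) + q * (\<alpha> * x1) = k\<^sup>2 * x1"
    unfolding x1_def x2_def using char by (simp add: algebra_simps power2_eq_square)
  have eqx2: "\<beta> * (\<alpha> * x1 + p * x2) = k\<^sup>2 * x2"
    unfolding x1_def x2_def by (simp add: algebra_simps)
  show ?thesis
    unfolding graph_eigenvalue_def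
  proof (intro exI[of _ x] conjI ballI)
    \<comment> \<open>If \<open>A'\<close> is empty, no vertex takes the value \<open>x2\<close>,
      but then \<open>p = 0\<close> and \<open>x1\<close> is \<open>k\<^sup>2\<close>.\<close>
    show "\<exists>v\<in>pverts G. x v \<noteq> 0"
    proof (cases "A' = {}")
      case True
      then have "x1 > 0" using k by (simp add: x1_def p_def)
      moreover obtain a where "a \<in> A" using sub by auto
      ultimately show ?thesis using verts True by (intro bexI[of _ a]) (auto simp: x_def)
    next
      case False
      then obtain a where "a \<in> A'" by auto
      then show ?thesis using verts sub pos by (intro bexI[of _ a]) (auto simp: x_def x2_def)
    qed
  next
    fix u assume u: "u \<in> pverts G"
    have kk: "y = k\<^sup>2 * z \<Longrightarrow> y / k = k * z" for y z
      using k(1) by (simp add: power2_eq_square)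
    have nbsum: "sum x B = k * x1" "sum x (B - B') = k * x2" "sum x A = \<alpha> * x1 + p * x2" "sum x (A - A') = \<alpha> * x1"
      using sA sA2 sB sB2 kk[OF eqx1, unfolded add_divide_distrib] kk[OF eqx2] by simp_all
    consider "u \<in> A'" | "u \<in> A - A'" | "u \<in> B'" | "u \<in> B - B'" using u verts by blast
    then show "(\<Sum>v | v \<in> pverts G \<and> (u, v) \<in> parcs G. x v) = k * x u"
    proof cases
      case 1
      then have "x u = x2" "u \<in> A" using sub by (auto simp: x_def)
      then show ?thesis unfolding nb[OF u] using 1 nbsum by simp
    next
      case 2
      then have "x u = x1" by (simp add: x_def)
      then show ?thesis unfolding nb[OF u] using 2 nbsum by simp
    next
      case 3
      then have "x u = \<alpha> * x1 / k" "u \<notin> A" using sub nA by (auto simp: x_def)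
      then show ?thesis unfolding nb[OF u] using 3 nbsum k by simp
    next
      case 4
      then have "x u = (\<alpha> * x1 + p * x2) / k" "u \<notin> A" using nA by (auto simp: x_def)
      then show ?thesis unfolding nb[OF u] using 4 nbsum k by simp
    qed
  qed
qed

section \<open>The maximal spectral radius\<close>

text \<open>Either \<open>u\<close> and \<open>v'\<close> lie on opposite sides, or
  \<open>u'\<close>, being opposite to \<open>v'\<close>, is opposite to \<open>u\<close>. This
  serves to certify that a graph is not complete bipartite.\<close>

lemma complete_bipartite_plus_isolated_arcs:
  assumes "complete_bipartite_plus_isolated G" "(u, v) \<in> parcs G" "(u', v') \<in> parcs G"
  shows "(u, v') \<in> parcs G \<or> (u, u') \<in> parcs G"
  using assms unfolding complete_bipartite_plus_isolated_def complete_bipartite_digraph_pair_def by auto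

text \<open>Without bad pairs the edge relation is the product of its two projections, and the
  vertices outside the projections are isolated.\<close>

lemma complete_bipartite_plus_isolatedI:
  assumes G: "pair_graph G" and AB: "bipartition G A B"
    and ne: "arcs_between G A B \<noteq> {}" and good: "bad_pairs (arcs_between G A B) = {}"
  shows "complete_bipartite_plus_isolated G"
proof -
  define E where "E = arcs_between G A B"
  define X where "X = fst ` E"
  define Y where "Y = snd ` E"
  have sub: "X \<subseteq> A" "Y \<subseteq> B" by (auto simp: X_def Y_def E_def arcs_between_def)
  have verts: "pverts G = A \<union> B" "A \<inter> B = {}" and arcs: "parcs G \<subseteq> A \<times> B \<union> B \<times> A"
    using AB by (auto simp: bipartition_def)
  have fin: "finite X" "finite Y" using sub finite_pverts[OF G] verts finite_subset by auto
  have E: "E = X \<times> Y"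
  proof
    show "X \<times> Y \<subseteq> E"
    proof clarify
      fix a b assume "a \<in> X" "b \<in> Y"
      then obtain b' a' where "(a, b') \<in> E" "(a', b) \<in> E" by (auto simp: X_def Y_def)
      then show "(a, b) \<in> E" using good bad_pairsI[of a b' E a' b] by (auto simp: E_def)
    qed
  qed (force simp: X_def Y_def)
  have "(u, v) \<in> parcs G \<longleftrightarrow> (u, v) \<in> E \<or> (v, u) \<in> E" for u v
    using arcs parcs_sym[OF G, of u v] by (auto simp: E_def arcs_between_def)
  then have arcs_eq: "parcs G = X \<times> Y \<union> Y \<times> X" unfolding E by auto
  have "X \<noteq> {}" "Y \<noteq> {}" using ne by (auto simp: X_def Y_def E_def)
  then have "card X \<ge> 1" "card Y \<ge> 1" using fin by (simp_all add: Suc_le_eq card_gt_0_iff)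
  have "X \<inter> Y = {}" "X \<union> Y \<subseteq> pverts G" using sub verts by auto
  have "complete_bipartite_digraph (card X) (card Y) (with_proj \<lparr>pverts = X \<union> Y, parcs = parcs G\<rparr>)"
    unfolding complete_bipartite_digraph_pair_def using fin arcs_eq \<open>X \<inter> Y = {}\<close>
    by (simp only: pair_pre_digraph.simps finite_Un) blast
  then show ?thesis
    unfolding complete_bipartite_plus_isolated_def
    using \<open>card X \<ge> 1\<close> \<open>card Y \<ge> 1\<close> \<open>X \<union> Y \<subseteq> pverts G\<close> by blast
qed

text \<open>\<open>Field (parcs G)\<close> is the set of non-isolated vertices. An eigenvector for a
  nonzero eigenvalue vanishes at the isolated ones, so it can be carried along \<open>f\<close> and
  extended by 0 to the rest of \<open>U\<close>.\<close>

lemma graph_eigenvalue_relabel: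
  assumes wf: "parcs G \<subseteq> pverts G \<times> pverts G"
    and f: "inj_on f (Field (parcs G))" "f ` Field (parcs G) \<subseteq> U"
    and k: "k \<noteq> 0" "graph_eigenvalue G k"
  shows "graph_eigenvalue \<lparr>pverts = U, parcs = map_prod f f ` parcs G\<rparr> k"
proof -
  let ?W = "Field (parcs G)"
  obtain x v0 where x: "v0 \<in> pverts G" "x v0 \<noteq> 0"
    and eig: "\<And>u. u \<in> pverts G \<Longrightarrow> (\<Sum>v | v \<in> pverts G \<and> (u, v) \<in> parcs G. x v) = k * x u"
    using k unfolding graph_eigenvalue_def by blast
  define y where "y j = (if j \<in> f ` ?W then x (the_inv_into ?W f j) else 0)" for j
  have y: "y (f w) = x w" if "w \<in> ?W" for w
    using that f by (auto simp: y_def the_inv_into_f_f)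
  have "v0 \<in> ?W"
  proof (rule ccontr)
    assume "v0 \<notin> ?W"
    then have "{v. v \<in> pverts G \<and> (v0, v) \<in> parcs G} = {}" by (auto simp: Field_def)
    then show False using eig[OF x(1)] x k by (simp only: sum.empty) simp
  qed
  show ?thesis
    unfolding graph_eigenvalue_def
  proof (intro exI[of _ y] conjI ballI)
    show "\<exists>v\<in>pverts \<lparr>pverts = U, parcs = map_prod f f ` parcs G\<rparr>. y v \<noteq> 0"
      using \<open>v0 \<in> ?W\<close> f x y by (intro bexI[of _ "f v0"]) auto
  next
    fix j assume "j \<in> pverts \<lparr>pverts = U, parcs = map_prod f f ` parcs G\<rparr>"
    let ?S = "{v. v \<in> U \<and> (j, v) \<in> map_prod f f ` parcs G}"
    have "sum y ?S = k * y j"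
    proof (cases "j \<in> f ` ?W")
      case False
      then have "?S = {}" by (auto simp: Field_def image_iff Domain_iff)
      then show ?thesis using False by (simp only: y_def) simp
    next
      case True
      then obtain w where w: "w \<in> ?W" "j = f w" by auto
      let ?N = "{v. v \<in> pverts G \<and> (w, v) \<in> parcs G}"
      have NW: "?N \<subseteq> ?W" by (auto simp: Field_def)
      have "?S = f ` ?N"
      proof
        show "?S \<subseteq> f ` ?N"
        proof
          fix v assume "v \<in> ?S"
          then obtain a b where ab: "(a, b) \<in> parcs G" "f w = f a" "v = f b" using w by auto
          then have "w = a" using f(1) w by (auto dest!: inj_onD simp: Field_def)
          then show "v \<in> f ` ?N" using ab wf by auto
        qed
        show "f ` ?N \<subseteq> ?S" using w f NW by (force simp: Field_def)
      qed
      then have "sum y ?S = (\<Sum>v\<in>?N. y (f v))"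
        using sum.reindex[OF inj_on_subset[OF f(1) NW], of y] by simp
      also have "\<dots> = sum x ?N" using NW y by (intro sum.cong) auto
      also have "\<dots> = k * y j" using eig[of w] w wf y by (auto simp: Field_def)
      finally show ?thesis .
    qed
    then show "(\<Sum>v | v \<in> pverts \<lparr>pverts = U, parcs = map_prod f f ` parcs G\<rparr> \<and>
        (j, v) \<in> parcs \<lparr>pverts = U, parcs = map_prod f f ` parcs G\<rparr>. y v) = k * y j" by simp
  qed
qed

section \<open>Competitors and the attainment of the maximum\<close>

definition competitor :: "nat \<Rightarrow> nat pair_pre_digraph \<Rightarrow> bool" where
  "competitor e G \<longleftrightarrow>
     pair_graph G \<and> bipartite G \<and> card (edges G) = e \<and> \<not> complete_bipartite_plus_isolated G"

lemma pverts_nonempty_if_edges: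
  assumes "pair_graph G" "card (edges G) > 0"
  shows "pverts G \<noteq> {}"
proof -
  interpret pair_graph G by fact
  have "edges G \<noteq> {}" using assms(2) by auto
  then show ?thesis using in_arcsD1 by (auto simp: edges_def)
qed

text \<open>
  The number of vertices is unbounded, but isolated vertices do not contribute to nonzero
  eigenvalues, and the at most \<open>2 e\<close> others can be relabelled.
\<close>

lemma finite_rho_competitors:
  assumes "e > 0"
  shows "finite (rho ` {G. competitor e G})"
proof -
  let ?H = "\<lambda>R. \<lparr>pverts = {..<2 * e}, parcs = R\<rparr> :: nat pair_pre_digraph"
  let ?Rs = "Pow ({..<2 * e} \<times> {..<2 * e})"
  \<comment> \<open>The value 0 is listed apart because the relabelling onto
    \<open>{..<2 * e}\<close> treats nonzero eigenvalues only; on that vertex set there are finitely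
    many arc sets.\<close>
  have "rho G \<in> {0} \<union> (\<Union>R\<in>?Rs. {k. graph_eigenvalue (?H R) k})" if "competitor e G" for G
  proof (cases "rho G = 0")
    case False
    have G: "pair_graph G" and e: "card (edges G) = e" using that by (auto simp: competitor_def)
    interpret pair_graph G by fact
    have "\<exists>A B. bipartition G A B" using that by (simp add: competitor_def bipartite_iff_bipartition)
    then obtain A B where AB: "bipartition G A B" by (elim exE)
    let ?E = "arcs_between G A B" and ?W = "Field (parcs G)"
    have finE: "finite ?E" using pair_finite_arcs by (simp add: arcs_between_def)
    have "?W \<subseteq> fst ` ?E \<union> snd ` ?E"
    proof
      fix w assume "w \<in> ?W"
      then obtain v where "(w, v) \<in> parcs G" "(v, w) \<in> parcs G"
        using parcs_sym[OF G] unfolding Field_def by blast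
      then have "(w, v) \<in> ?E \<or> (v, w) \<in> ?E"
        using AB unfolding bipartition_def arcs_between_def by blast
      then show "w \<in> fst ` ?E \<union> snd ` ?E" by (metis UnI1 UnI2 fst_conv image_eqI snd_conv)
    qed
    then have "card ?W \<le> card (fst ` ?E \<union> snd ` ?E)" using finE by (intro card_mono) auto
    also have "\<dots> \<le> card (fst ` ?E) + card (snd ` ?E)" by (rule card_Un_le)
    also have "\<dots> \<le> 2 * e"
      using card_image_le[OF finE, of fst] card_image_le[OF finE, of snd] card_edges_eq[OF G AB] e by simp
    finally have "card ?W \<le> card {..<2 * e}" by simp
    moreover have "finite ?W" using pair_finite_arcs finite_Field by blast
    ultimately obtain f where f: "inj_on f ?W" "f ` ?W \<subseteq> {..<2 * e}"
      using card_le_inj[of ?W "{..<2 * e}"] by auto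
    have "graph_eigenvalue G (rho G)"
      using graph_eigenvalue_rho[OF G] pverts_nonempty_if_edges[OF G] e assms by simp
    moreover have "parcs G \<subseteq> pverts G \<times> pverts G" using in_arcsD1 in_arcsD2 by auto
    ultimately have "graph_eigenvalue (?H (map_prod f f ` parcs G)) (rho G)"
      using graph_eigenvalue_relabel f False by blast
    moreover have "map_prod f f ` parcs G \<in> ?Rs" using f unfolding Field_def by fastforce
    ultimately show ?thesis by blast
  qed simp
  then have "rho ` {G. competitor e G} \<subseteq> {0} \<union> (\<Union>R\<in>?Rs. {k. graph_eigenvalue (?H R) k})"
    by blast
  moreover have "finite {k. graph_eigenvalue (?H R) k}" for R
    by (rule finite_graph_eigenvalues) simp
  then have "finite ({0} \<union> (\<Union>R\<in>?Rs. {k. graph_eigenvalue (?H R) k}))"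
    by (intro finite_UnI finite_UN_I finite_Pow_iff[THEN iffD2]) simp_all
  ultimately show ?thesis by (rule finite_subset)
qed

text \<open>\<open>Greatest\<close> in \<open>rho_max\<close> can be read as \<open>Max\<close>,
  since the values of the competitors form a finite set, which \<open>G\<close> makes
  nonempty.\<close>

lemma
  assumes "e > 0" "competitor e G"
  shows rho_le_rho_max: "rho G \<le> rho_max e"
    and rho_max_attained: "\<exists>H. competitor e H \<and> rho H = rho_max e"
proof -
  let ?S = "rho ` {G. competitor e G}"
  have fin: "finite ?S" and ne: "?S \<noteq> {}" using finite_rho_competitors assms by auto
  have "rho_max e = (GREATEST r. r \<in> ?S)"
    unfolding rho_max_def competitor_def by (rule arg_cong[of _ _ Greatest]) (auto simp: image_iff)
  also have "\<dots> = Max ?S" using fin ne by (intro Greatest_equality) (auto simp del: image_eqI)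
  finally have max: "rho_max e = Max ?S" .
  show "rho G \<le> rho_max e" unfolding max using fin assms(2) by (intro Max_ge) auto
  have "Max ?S \<in> ?S" using fin ne by (rule Max_in)
  then show "\<exists>H. competitor e H \<and> rho H = rho_max e" unfolding max by auto
qed

text \<open>The graph is complete bipartite with parts of orders \<open>\<alpha> + p\<close> and
  \<open>\<beta> + q\<close>, minus a biclique with parts of orders \<open>p\<close> and
  \<open>q\<close>. One missing edge is \<open>p = q = 1\<close>; a pendant vertex arises from
  \<open>\<alpha> = q = 1\<close>.\<close>

lemma competitor_biclique_minus_biclique:
  assumes pos: "\<alpha> \<ge> 1" "\<beta> \<ge> 1" "p \<ge> 1" "q \<ge> 1" and e: "e = \<alpha> * \<beta> + \<alpha> * q + \<beta> * p"
    and k: "k > 0" "k ^ 4 + real (\<alpha> * \<beta> * p * q) = real e * k\<^sup>2"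
  shows "\<exists>G. competitor e G \<and> k \<le> rho G"
proof -
  define A B where "A = {..<\<alpha> + p}" and "B = {\<alpha> + p..<\<alpha> + p + (\<beta> + q)}"
  define A' B' where "A' = {..<p}" and "B' = {\<alpha> + p..<\<alpha> + p + q}"
  define E where "E = A \<times> B - A' \<times> B'"
  define G where "G = \<lparr>pverts = A \<union> B, parcs = E \<union> E\<inverse>\<rparr>"
  have disj: "A \<inter> B = {}" by (auto simp: A_def B_def)
  have sub: "A' \<subset> A" "B' \<subset> B" using pos by (auto simp: A_def B_def A'_def B'_def)
  have fin: "finite A" "finite B" "finite A'" "finite B'" by (auto simp: A_def B_def A'_def B'_def)
  have G: "pair_graph G"
  proof unfold_locales
    show "finite (parcs G)" using fin by (simp add: G_def E_def)
    show "symmetric G" by (auto simp: G_def symmetric_def sym_def)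
  qed (use fin disj in \<open>auto simp: G_def E_def\<close>)
  have AB: "bipartition G A B" using disj by (auto simp: bipartition_def G_def E_def)
  have EG: "arcs_between G A B = A \<times> B - A' \<times> B'" using disj by (auto simp: arcs_between_def G_def E_def)
  have "card A = \<alpha> + p" "card B = \<beta> + q" "card A' = p" "card B' = q"
    by (simp_all add: A_def B_def A'_def B'_def)
  moreover from this have "card (A - A') = \<alpha>" "card (B - B') = \<beta>"
    using fin sub by (auto simp: card_Diff_subset)
  moreover have "card (A \<times> B - A' \<times> B') = card (A \<times> B) - card (A' \<times> B')"
    using fin sub by (intro card_Diff_subset) auto
  ultimately have cards: "card (edges G) = e" "card (A - A') = \<alpha>" "card (B - B') = \<beta>" "card A' = p" "card B' = q"
    unfolding card_edges_eq[OF G AB] EG by (auto simp: card_cartesian_product e algebra_simps)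
  have "\<not> complete_bipartite_plus_isolated G"
  proof
    assume *: "complete_bipartite_plus_isolated G"
    \<comment> \<open>One vertex from each block: the edges \<open>(a, b)\<close> and
      \<open>(a', b')\<close> exist, but \<open>(a, b')\<close> was removed and \<open>a\<close>,
      \<open>a'\<close> are on the same side.\<close>
    define a a' b b' where "a = (0 :: nat)" and "a' = p" and "b = \<alpha> + p + q" and "b' = \<alpha> + p"
    have "a \<in> A'" "a' \<in> A - A'" "b \<in> B - B'" "b' \<in> B'"
      using pos by (auto simp: a_def a'_def b_def b'_def A_def A'_def B_def B'_def)
    then have "(a, b) \<in> parcs G" "(a', b') \<in> parcs G" "(a, b') \<notin> parcs G" "(a, a') \<notin> parcs G"
      using sub disj by (auto simp: G_def E_def)
    then show False using complete_bipartite_plus_isolated_arcs[OF *] by blast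
  qed
  then have "competitor e G" using G AB cards by (auto simp: competitor_def bipartite_def bipartition_def)
  moreover have "graph_eigenvalue G k"
    using k cards sub by (intro graph_eigenvalue_biclique_minus_biclique[OF G AB EG]) auto
  then have "k \<le> rho G" using graph_eigenvalue_le_rho finite_pverts[OF G] by blast
  ultimately show ?thesis by blast
qed


text \<open>A competitor has at least one bad pair, which makes the fourth-power bound
  strict.\<close>

lemma competitor_rho_power4_lt:
  assumes "competitor e H" "e > 0"
  shows "rho H ^ 4 < (real e)\<^sup>2"
proof -
  have H: "pair_graph H" and e: "card (edges H) = e" using assms by (auto simp: competitor_def)
  have "\<exists>A B. bipartition H A B" using assms by (simp add: competitor_def bipartite_iff_bipartition)
  then obtain A B where AB: "bipartition H A B" by (elim exE)
  have "arcs_between H A B \<noteq> {}" using card_edges_eq[OF H AB] e assms by auto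
  then have "bad_pairs (arcs_between H A B) \<noteq> {}"
    using complete_bipartite_plus_isolatedI[OF H AB] assms by (auto simp: competitor_def)
  moreover have "finite (arcs_between H A B)"
    using card_edges_eq[OF H AB] e assms(2) card_ge_0_finite[of "arcs_between H A B"] by simp
  ultimately have "card (bad_pairs (arcs_between H A B)) > 0"
    using finite_bad_pairs card_gt_0_iff by blast
  moreover have "graph_eigenvalue H (rho H)"
    using graph_eigenvalue_rho[OF H] pverts_nonempty_if_edges[OF H] e assms by simp
  ultimately show ?thesis using graph_eigenvalue_power4_le[OF H AB, of "rho H"] e by simp
qed

text \<open>The number of bad pairs is at most e^2 - \<mu>^2 = 2 c + (e - \<mu>)^2, and the last
  square is below 1, so integrality removes it.\<close>

lemma extremal_graph_bounds:
  assumes G: "pair_graph G" and AB: "bipartition G A B" and rho: "rho G = rho_max e"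
    and eG: "card (edges G) = e"
    and pos: "\<alpha> \<ge> 1" "\<beta> \<ge> 1" "p \<ge> 1" "q \<ge> 1" and e: "e = \<alpha> * \<beta> + \<alpha> * q + \<beta> * p"
    and c: "\<alpha> * \<beta> * p * q + 2 \<le> e"
  shows "card (bad_pairs (arcs_between G A B)) \<le> 2 * (\<alpha> * \<beta> * p * q)"
    and "arcs_between G A B \<noteq> A \<times> B"
proof -
  define c where "c = real (\<alpha> * \<beta> * p * q)"
  define D where "D = card (bad_pairs (arcs_between G A B))"
  define s where "s = sqrt ((real e)\<^sup>2 - 4 * c)"
  define \<mu> where "\<mu> = (e + s) / 2"
  have c2: "c + 2 \<le> real e" "c \<ge> 0" using c unfolding c_def by linarith+
  \<comment> \<open>Here \<open>c + 2 \<le> e\<close> is spent: it puts \<open>s\<close> above e - 2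
    and hence \<open>\<mu>\<close> above e - 1.\<close>
  have "(real e - 2)\<^sup>2 < (real e)\<^sup>2 - 4 * c" using c2 by (simp add: power2_eq_square algebra_simps)
  moreover from this have "(real e)\<^sup>2 - 4 * c \<ge> 0"
    using zero_le_power2[of "real e - 2"] by linarith
  ultimately have s: "real e - 2 < s" "s\<^sup>2 = (real e)\<^sup>2 - 4 * c" "s \<ge> 0"
    unfolding s_def using real_less_rsqrt by auto
  have \<mu>: "\<mu> > real e - 1" "\<mu> > 0" "\<mu>\<^sup>2 + c = real e * \<mu>"
    using s c2 by (auto simp: \<mu>_def field_simps power2_eq_square)
  have "s\<^sup>2 \<le> (real e)\<^sup>2" using s(2) c2 by simp
  then have "s \<le> real e" by (rule power2_le_imp_le) simp
  then have "\<mu> \<le> real e" by (simp add: \<mu>_def)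
  have k4: "sqrt \<mu> ^ 4 = \<mu>\<^sup>2" using \<mu>(2) power_mult[of "sqrt \<mu>" 2 2] by simp
  have "\<exists>H. competitor e H \<and> sqrt \<mu> \<le> rho H"
    using \<mu> k4 by (intro competitor_biclique_minus_biclique[OF pos e]) (auto simp: c_def)
  then obtain H where H: "competitor e H" "sqrt \<mu> \<le> rho H" by blast
  have "e > 0" using c by simp
  have ge: "sqrt \<mu> \<le> rho G" using rho_le_rho_max[OF \<open>e > 0\<close> H(1)] H(2) rho by simp
  have "graph_eigenvalue G (rho G)"
    using graph_eigenvalue_rho[OF G] pverts_nonempty_if_edges[OF G] eG \<open>e > 0\<close> by simp
  then have "rho G ^ 4 + real D \<le> (real e)\<^sup>2"
    using graph_eigenvalue_power4_le[OF G AB] eG by (simp add: D_def)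
  moreover have "\<mu>\<^sup>2 \<le> rho G ^ 4" using power_mono[OF ge, of 4] \<mu>(2) k4 by simp
  moreover have "(real e)\<^sup>2 - \<mu>\<^sup>2 = 2 * c + (real e - \<mu>)\<^sup>2"
    using \<mu>(3) by (simp add: power2_eq_square algebra_simps)
  moreover have "(real e - \<mu>)\<^sup>2 < 1" using \<mu>(1) \<open>\<mu> \<le> real e\<close> by (simp add: abs_square_less_1)
  ultimately have "real D < 2 * c + 1" by linarith
  then show "card (bad_pairs (arcs_between G A B)) \<le> 2 * (\<alpha> * \<beta> * p * q)"
    unfolding D_def c_def by linarith
  \<comment> \<open>The equation \<open>rho G = rho_max e\<close> does not by itself say that
    \<open>G\<close> is a competitor. A complete bipartite \<open>G\<close> would have spectral
    radius at least the square root of \<open>e\<close>, while the competitor attaining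
    \<open>rho_max e\<close> stays strictly below it.\<close>
  show "arcs_between G A B \<noteq> A \<times> B"
  proof
    assume complete: "arcs_between G A B = A \<times> B"
    then have "card (A \<times> B) > 0" using card_edges_eq[OF G AB] eG \<open>e > 0\<close> by simp
    then have "A \<noteq> {}" "B \<noteq> {}" by auto
    have k4: "sqrt (real e) ^ 4 = (real e)\<^sup>2" using power_mult[of "sqrt (real e)" 2 2] by simp
    then have "graph_eigenvalue G (sqrt (real e))"
      using complete \<open>A \<noteq> {}\<close> \<open>B \<noteq> {}\<close> \<open>e > 0\<close> eG
      by (intro graph_eigenvalue_biclique_minus_biclique[OF G AB, of "{}" "{}"])
         (auto simp: power2_eq_square)
    then have "sqrt (real e) \<le> rho G" using graph_eigenvalue_le_rho finite_pverts[OF G] by blast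
    then have "sqrt (real e) ^ 4 \<le> rho G ^ 4" by (intro power_mono) auto
    moreover obtain H' where "competitor e H'" "rho H' = rho G"
      using rho_max_attained[OF \<open>e > 0\<close> H(1)] rho by auto
    ultimately show False using competitor_rho_power4_lt[of e H'] \<open>e > 0\<close> k4 by simp
  qed
qed

section \<open>Identification of the extremal graphs\<close>

lemma graph_isoI:
  assumes G: "pair_graph G" and f: "bij_betw f (pverts G) (pverts H)"
    and H: "parcs H \<subseteq> pverts H \<times> pverts H"
    and arcs: "\<And>u v. u \<in> pverts G \<Longrightarrow> v \<in> pverts G \<Longrightarrow> (u, v) \<in> parcs G \<longleftrightarrow> (f u, f v) \<in> parcs H"
  shows "G \<simeq>\<^sub>G H"
proof -
  let ?f = "\<lparr>iso_verts = f, iso_arcs = map_prod f f, iso_head = snd, iso_tail = fst\<rparr>"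
  have inj: "inj_on f (pverts G)" and surj: "f ` pverts G = pverts H"
    using f by (auto simp: bij_betw_def)
  have GV: "parcs G \<subseteq> pverts G \<times> pverts G" by (rule parcs_subset[OF G])
  have injA: "inj_on (map_prod f f) (parcs G)"
    using map_prod_inj_on[OF inj inj] GV by (rule inj_on_subset)
  have img: "map_prod f f ` parcs G = parcs H"
  proof (intro equalityI subsetI)
    fix z assume "z \<in> map_prod f f ` parcs G"
    then obtain u v where uv: "(u, v) \<in> parcs G" "z = (f u, f v)" by (rule imageE) auto
    then have "u \<in> pverts G" "v \<in> pverts G" using GV by auto
    then show "z \<in> parcs H" using arcs[of u v] uv by simp
  next
    fix z assume z: "z \<in> parcs H"
    then have "fst z \<in> f ` pverts G" "snd z \<in> f ` pverts G" using H unfolding surj by auto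
    then obtain u v where uv: "u \<in> pverts G" "v \<in> pverts G" "z = (f u, f v)"
      by (elim imageE) (metis prod.collapse)
    then have "(u, v) \<in> parcs G" using arcs[of u v] z by simp
    then show "z \<in> map_prod f f ` parcs G" using uv(3) by (intro image_eqI[of _ _ "(u, v)"]) simp_all
  qed
  have "with_proj H = app_iso ?f (with_proj G)"
    by (simp add: app_iso_def with_proj_def surj img)
  moreover have "wf_digraph (with_proj G)"
    unfolding wf_digraph_wp_iff using G
    by (simp add: pair_graph_def pair_digraph_def pair_fin_digraph_def)
  then have "pre_digraph.digraph_isomorphism (with_proj G) ?f"
    using inj injA by (simp add: pre_digraph.digraph_isomorphism_def)
  ultimately show ?thesis unfolding digraph_iso_def by (intro exI[of _ ?f] conjI)
qed

text \<open>A transposition after an arbitrary enumeration gives the distinguished vertex the label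
  prescribed in \<open>K_minus\<close> or \<open>K_plus\<close>.\<close>

lemma ex_bij_betw_lessThan_mapsto:
  assumes "finite A" "a \<in> A" "j < card A"
  shows "\<exists>g. bij_betw g A {..<card A} \<and> g a = (j :: nat)"
proof -
  obtain g where g: "bij_betw g A {..<card A}"
    using ex_bij_betw_finite_nat[OF assms(1)] by (auto simp: atLeast0LessThan)
  then have "g a < card A" using assms(2) by (auto simp: bij_betw_def)
  then have "bij_betw (transpose (g a) j) {..<card A} {..<card A}"
    using assms(3) by (intro permutes_imp_bij permutes_swap_id) auto
  then have "bij_betw (transpose (g a) j \<circ> g) A {..<card A}"
    using g bij_betw_trans by blast
  then show ?thesis by (intro exI[of _ "transpose (g a) j \<circ> g"]) simp
qed

lemma bij_betw_sum_cases:
  assumes "bij_betw g A X" "bij_betw h B Y" "A \<inter> B = {}"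
  shows "bij_betw (\<lambda>v. if v \<in> A then Inl (g v) else Inr (h v)) (A \<union> B) (Inl ` X \<union> Inr ` Y)"
proof (rule bij_betw_imageI)
  let ?f = "\<lambda>v. if v \<in> A then Inl (g v) else Inr (h v)"
  show "inj_on ?f (A \<union> B)"
    using assms(1,2) by (auto simp: bij_betw_def intro!: inj_onI dest: inj_onD split: if_splits)
  have "?f ` A = Inl ` g ` A" by (force simp: image_image)
  moreover have "v \<notin> A" if "v \<in> B" for v using that assms(3) by auto
  then have "?f ` B = Inr ` h ` B" unfolding image_image by (intro image_cong) auto
  ultimately show "?f ` (A \<union> B) = Inl ` X \<union> Inr ` Y"
    using assms(1,2) by (simp only: image_Un bij_betw_def)
qed

lemma parcs_eq_arcs_between:
  assumes "pair_graph G" "bipartition G A B"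
  shows "parcs G = arcs_between G A B \<union> (arcs_between G A B)\<inverse>"
  using assms(2) parcs_sym[OF assms(1)] by (auto simp: bipartition_def arcs_between_def)

lemma iso_K_minusI:
  assumes G: "pair_graph G" and AB: "bipartition G A B"
    and E: "arcs_between G A B = A \<times> B - {a0} \<times> {b0}" and ab: "a0 \<in> A" "b0 \<in> B"
  shows "G \<simeq>\<^sub>G K_minus (card A) (card B)"
proof -
  have verts: "pverts G = A \<union> B" "A \<inter> B = {}" using AB by (auto simp: bipartition_def)
  have fin: "finite A" "finite B" using finite_pverts[OF G] verts by auto
  have "card A > 0" "card B > 0" using ab fin card_gt_0_iff by blast+
  then obtain g h where g: "bij_betw g A {..<card A}" "g a0 = 0" and h: "bij_betw h B {..<card B}" "h b0 = 0"
    using ex_bij_betw_lessThan_mapsto fin ab by metis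
  define f where "f v = (if v \<in> A then Inl (g v) else Inr (h v))" for v
  have fA: "f v = Inl (g v)" "g v < card A" "g v = 0 \<longleftrightarrow> v = a0" if "v \<in> A" for v
    using that g ab by (auto simp: f_def bij_betw_def inj_on_def)
  have fB: "f v = Inr (h v)" "h v < card B" "h v = 0 \<longleftrightarrow> v = b0" if "v \<in> B" for v
    using that h ab verts by (auto simp: f_def bij_betw_def inj_on_def)
  show ?thesis
  proof (rule graph_isoI[OF G])
    show "bij_betw f (pverts G) (pverts (K_minus (card A) (card B)))"
      using bij_betw_sum_cases[OF g(1) h(1) verts(2)]
      by (simp add: f_def[abs_def] K_minus_def K_complete_def verts(1))
    show "parcs (K_minus (card A) (card B)) \<subseteq> pverts (K_minus (card A) (card B)) \<times> pverts (K_minus (card A) (card B))"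
      by (auto simp: K_minus_def K_complete_def)
    fix u v assume "u \<in> pverts G" "v \<in> pverts G"
    then consider "u \<in> A" "v \<in> A" | "u \<in> A" "v \<in> B" | "u \<in> B" "v \<in> A" | "u \<in> B" "v \<in> B"
      using verts by blast
    then show "(u, v) \<in> parcs G \<longleftrightarrow> (f u, f v) \<in> parcs (K_minus (card A) (card B))"
      using verts(2) unfolding parcs_eq_arcs_between[OF G AB] E
      by cases (auto simp: K_minus_def K_complete_def fA fB)
  qed
qed

text \<open>\<open>K_plus s t\<close> is seen as \<open>K_complete s (t + 1)\<close> with all edges
  but one removed at a single vertex. That pendant vertex is \<open>b1\<close>, labelled
  \<open>t\<close>; hence \<open>card B - 1\<close>.\<close>

lemma iso_K_plusI:
  assumes G: "pair_graph G" and AB: "bipartition G A B"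
    and E: "arcs_between G A B = A \<times> B - (A - {a0}) \<times> {b1}" and ab: "a0 \<in> A" "b1 \<in> B"
  shows "G \<simeq>\<^sub>G K_plus (card A) (card B - 1)"
proof -
  have verts: "pverts G = A \<union> B" "A \<inter> B = {}" using AB by (auto simp: bipartition_def)
  have fin: "finite A" "finite B" using finite_pverts[OF G] verts by auto
  define t where "t = card B - 1"
  have "card A > 0" "card B > 0" using ab fin card_gt_0_iff by blast+
  then have t: "card B = Suc t" by (simp add: t_def)
  obtain g h where g: "bij_betw g A {..<card A}" "g a0 = 0" and h: "bij_betw h B {..<card B}" "h b1 = t"
    using ex_bij_betw_lessThan_mapsto fin ab \<open>card A > 0\<close> t by (metis lessI)
  define f where "f v = (if v \<in> A then Inl (g v) else Inr (h v))" for v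
  have fA: "f v = Inl (g v)" "g v < card A" "g v = 0 \<longleftrightarrow> v = a0" if "v \<in> A" for v
    using that g ab by (auto simp: f_def bij_betw_def inj_on_def)
  have fB: "f v = Inr (h v)" "h v < Suc t" "h v = t \<longleftrightarrow> v = b1" if "v \<in> B" for v
    using that h ab verts t by (auto simp: f_def bij_betw_def inj_on_def)
  have fB2: "h v < t \<longleftrightarrow> v \<noteq> b1" if "v \<in> B" for v
    using fB(2,3)[OF that] by auto
  have "G \<simeq>\<^sub>G K_plus (card A) t"
  proof (rule graph_isoI[OF G])
    show "bij_betw f (pverts G) (pverts (K_plus (card A) t))"
      using bij_betw_sum_cases[OF g(1) h(1) verts(2)]
      by (simp add: f_def[abs_def] K_plus_def K_complete_def verts(1) t lessThan_Suc)
    have "Inl 0 \<in> Inl ` {..<card A}" using \<open>card A > 0\<close> by simp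
    then show "parcs (K_plus (card A) t) \<subseteq> pverts (K_plus (card A) t) \<times> pverts (K_plus (card A) t)"
      by (auto simp: K_plus_def K_complete_def)
    fix u v assume "u \<in> pverts G" "v \<in> pverts G"
    then consider "u \<in> A" "v \<in> A" | "u \<in> A" "v \<in> B" | "u \<in> B" "v \<in> A" | "u \<in> B" "v \<in> B"
      using verts by blast
    then show "(u, v) \<in> parcs G \<longleftrightarrow> (f u, f v) \<in> parcs (K_plus (card A) t)"
      using verts(2) unfolding parcs_eq_arcs_between[OF G AB] E
      by cases (auto simp: K_plus_def K_complete_def fA fB fB2 image_iff)
  qed
  then show ?thesis by (simp add: t_def)
qed

text \<open>Otherwise \<open>p * q\<close>, \<open>\<beta> * p\<close> and
  \<open>\<alpha> * q\<close> are all at least 2, which forces the sum on the right to be at most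
  \<open>\<alpha> * \<beta> * p * q + 2\<close>. The outcomes are a single missing edge and a
  pendant vertex on either side.\<close>

lemma biclique_minus_biclique_arith:
  fixes \<alpha> \<beta> p q :: nat
  assumes "\<alpha> \<ge> 1" "\<beta> \<ge> 1" "p \<ge> 1" "q \<ge> 1" and le: "\<alpha> * \<beta> * p * q + 3 \<le> \<alpha> * \<beta> + \<alpha> * q + \<beta> * p"
  shows "p = 1 \<and> q = 1 \<or> \<beta> = 1 \<and> p = 1 \<or> \<alpha> = 1 \<and> q = 1"
proof (rule ccontr)
  assume *: "\<not> ?thesis"
  have "2 \<le> n * m" if "n \<ge> 1" "m \<ge> 1" "\<not> (n = 1 \<and> m = 1)" for n m :: nat
    using that mult_le_mono[of 2 n 1 m] mult_le_mono[of 1 n 2 m] by (cases "n = 1") auto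
  then have ge: "2 \<le> p * q" "2 \<le> \<beta> * p" "2 \<le> \<alpha> * q" using * assms by blast+
  obtain x y where xy: "\<beta> * p = 2 + x" "\<alpha> * q = 2 + y" using ge le_Suc_ex by metis
  have eq: "\<alpha> * \<beta> * p * q = (\<beta> * p) * (\<alpha> * q)" "\<alpha> * \<beta> * p * q = \<alpha> * \<beta> * (p * q)" by (simp_all add: ac_simps)
  have "2 * (\<alpha> * \<beta>) \<le> \<alpha> * \<beta> * p * q" unfolding eq(2) using ge(1) by simp
  moreover have "2 * (\<beta> * p) + 2 * (\<alpha> * q) \<le> \<alpha> * \<beta> * p * q + 4"
    unfolding eq(1) xy by (simp add: algebra_simps)
  ultimately show False using le by linarith
qed

text \<open>Both orders of \<open>s\<close> and \<open>t\<close> are recorded for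
  \<open>K_minus\<close>, as either part may be the smaller one. The last clause, needed for odd
  \<open>e\<close>, says that a pendant vertex added to \<open>K_complete 2 t\<close> amounts to one
  missing edge in \<open>K_complete 2 (t + 1)\<close>.\<close>

lemma iso_K_minus_or_K_plus_if_few_bad_pairs:
  assumes G: "pair_graph G" and AB: "bipartition G A B" and iso: "no_isolated_vertices G"
    and ne: "arcs_between G A B \<noteq> A \<times> B"
    and few: "card (bad_pairs (arcs_between G A B)) + 6 \<le> 2 * card (edges G)"
  shows "(\<exists>s t. s \<ge> 2 \<and> t \<ge> 2 \<and> s * t = card (edges G) + 1 \<and>
            2 * ((s - 1) * (t - 1)) \<le> card (bad_pairs (arcs_between G A B)) \<and>
            G \<simeq>\<^sub>G K_minus s t \<and> G \<simeq>\<^sub>G K_minus t s) \<or>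
         (\<exists>s t. s \<ge> 2 \<and> t \<ge> 1 \<and> s * t + 1 = card (edges G) \<and>
            2 * ((s - 1) * t) \<le> card (bad_pairs (arcs_between G A B)) \<and>
            G \<simeq>\<^sub>G K_plus s t \<and> (s = 2 \<longrightarrow> G \<simeq>\<^sub>G K_minus 2 (t + 1)))"
    (is "?minus \<or> ?plus")
proof -
  let ?E = "arcs_between G A B" and ?D = "card (bad_pairs (arcs_between G A B))"
  have verts: "pverts G = A \<union> B" "A \<inter> B = {}" and arcs: "parcs G \<subseteq> A \<times> B \<union> B \<times> A"
    using AB by (auto simp: bipartition_def)
  have fin: "finite A" "finite B" using finite_pverts[OF G] verts by auto
  have row: "\<exists>b. (a, b) \<in> ?E" if "a \<in> A" for a
    using that iso verts arcs unfolding no_isolated_vertices_def arcs_between_def by blast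
  have col: "\<exists>a. (a, b) \<in> ?E" if "b \<in> B" for b
    using that iso verts arcs parcs_sym[OF G] unfolding no_isolated_vertices_def arcs_between_def by blast
  have BA: "bipartition G B A" using AB by (rule bipartition_commute)
  have EBA: "arcs_between G B A = ?E\<inverse>" using parcs_sym[OF G] by (auto simp: arcs_between_def)
  obtain A' B' where sub: "A' \<subset> A" "B' \<subset> B" "A' \<noteq> {}" "B' \<noteq> {}" and E: "?E = A \<times> B - A' \<times> B'"
    and D: "2 * (card (A - A') * card (B - B') * card A' * card B') \<le> ?D"
    using nearly_complete_bipartite_if_few_bad_pairs[OF fin _ row col ne] few card_edges_eq[OF G AB]
    by (auto simp: arcs_between_def)
  define \<alpha> \<beta> p q where "\<alpha> = card (A - A')" and "\<beta> = card (B - B')" and "p = card A'" and "q = card B'"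
  have finp: "finite A'" "finite B'" using sub fin finite_subset by blast+
  have pos: "\<alpha> \<ge> 1" "\<beta> \<ge> 1" "p \<ge> 1" "q \<ge> 1"
    using sub fin finp by (auto simp: \<alpha>_def \<beta>_def p_def q_def Suc_le_eq card_gt_0_iff)
  have cards: "card A = \<alpha> + p" "card B = \<beta> + q"
    using sub fin finp card_mono[of A A'] card_mono[of B B']
    by (auto simp: \<alpha>_def \<beta>_def p_def q_def card_Diff_subset)
  have "card ?E = (\<alpha> + p) * (\<beta> + q) - p * q"
    unfolding E using sub finp by (subst card_Diff_subset) (auto simp: card_cartesian_product cards p_def q_def)
  then have e: "card (edges G) = \<alpha> * \<beta> + \<alpha> * q + \<beta> * p" using card_edges_eq[OF G AB] by (simp add: algebra_simps)
  have D: "2 * (\<alpha> * \<beta> * p * q) \<le> ?D" using D by (simp add: \<alpha>_def \<beta>_def p_def q_def)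
  then have "\<alpha> * \<beta> * p * q + 3 \<le> \<alpha> * \<beta> + \<alpha> * q + \<beta> * p" using few e by linarith
  then consider "p = 1" "q = 1" | "\<beta> = 1" "p = 1" | "\<alpha> = 1" "q = 1"
    using biclique_minus_biclique_arith[OF pos] by blast
  then show ?thesis
  proof cases
    case 1
    then obtain a0 b0 where ab: "A' = {a0}" "B' = {b0}" by (auto simp: p_def q_def card_1_singleton_iff)
    have "G \<simeq>\<^sub>G K_minus (card A) (card B)" using E sub unfolding ab by (intro iso_K_minusI[OF G AB]) auto
    moreover have "G \<simeq>\<^sub>G K_minus (card B) (card A)"
      using E sub unfolding ab by (intro iso_K_minusI[OF G BA, of b0 a0]) (auto simp: EBA)
    ultimately have ?minus using pos cards D e 1
      by - (rule exI[of _ "card A"], rule exI[of _ "card B"], auto)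
    then show ?thesis ..
  next
    case 2
    then obtain a1 b0 where ab: "A' = {a1}" "B - B' = {b0}" by (auto simp: p_def \<beta>_def card_1_singleton_iff)
    then have B': "B' = B - {b0}" "b0 \<in> B" using sub by auto
    have "G \<simeq>\<^sub>G K_plus (card B) (card A - 1)"
      using E sub B' unfolding ab by (intro iso_K_plusI[OF G BA, of b0 a1]) (auto simp: EBA)
    \<comment> \<open>With two vertices in \<open>B\<close>, one of them full, the removed biclique
      is a single edge.\<close>
    moreover have "G \<simeq>\<^sub>G K_minus 2 (\<alpha> + 1)" if two: "card B = 2"
    proof -
      have "card B' = 1" using two cards 2 by (simp add: q_def)
      then obtain b1 where "B' = {b1}" by (auto simp: card_1_singleton_iff)
      then have "G \<simeq>\<^sub>G K_minus (card B) (card A)"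
        using E sub unfolding ab by (intro iso_K_minusI[OF G BA, of b1 a1]) (auto simp: EBA)
      then show ?thesis using two cards 2 by simp
    qed
    ultimately have ?plus using pos cards D e 2
      by - (rule exI[of _ "card B"], rule exI[of _ \<alpha>], auto simp: algebra_simps)
    then show ?thesis ..
  next
    case 3
    then obtain a0 b1 where ab: "A - A' = {a0}" "B' = {b1}" by (auto simp: q_def \<alpha>_def card_1_singleton_iff)
    then have A': "A' = A - {a0}" "a0 \<in> A" using sub by auto
    have "G \<simeq>\<^sub>G K_plus (card A) (card B - 1)"
      using E sub A' unfolding ab by (intro iso_K_plusI[OF G AB, of a0 b1]) auto
    moreover have "G \<simeq>\<^sub>G K_minus 2 (\<beta> + 1)" if two: "card A = 2"
    proof -
      have "card A' = 1" using two cards 3 by (simp add: p_def)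
      then obtain a1 where "A' = {a1}" by (auto simp: card_1_singleton_iff)
      then have "G \<simeq>\<^sub>G K_minus (card A) (card B)"
        using E sub unfolding ab by (intro iso_K_minusI[OF G AB, of a1 b1]) auto
      then show ?thesis using two cards 3 by simp
    qed
    ultimately have ?plus using pos cards D e 3
      by - (rule exI[of _ "card A"], rule exI[of _ \<beta>], auto simp: algebra_simps)
    then show ?thesis ..
  qed
qed

section \<open>Least divisors and uniqueness of the parameters\<close>

lemma least_divisor:
  assumes "n > 1"
  shows least_divisor_gt_1: "least_divisor n > 1" and least_divisor_dvd: "least_divisor n dvd n"
    and least_divisor_le: "d > 1 \<Longrightarrow> d dvd n \<Longrightarrow> least_divisor n \<le> d"
proof -
  have "least_divisor n > 1 \<and> least_divisor n dvd n"
    unfolding least_divisor_def by (rule LeastI[of _ n]) (use assms in auto)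
  then show "least_divisor n > 1" "least_divisor n dvd n" by auto
  show "least_divisor n \<le> d" if "d > 1" "d dvd n"
    unfolding least_divisor_def using that by (intro Least_le) auto
qed

text \<open>Oddness excludes the divisor 2, and the cofactor is itself a divisor greater than 1,
  hence not below the least one.\<close>

lemma least_divisor_composite:
  assumes "n > 1" "odd n" "\<not> prime n"
  shows "least_divisor n \<ge> 3" "least_divisor n * (n div least_divisor n) = n"
    "n div least_divisor n \<ge> least_divisor n"
proof -
  let ?p = "least_divisor n" and ?q = "n div least_divisor n"
  have p: "?p > 1" "?p dvd n" using least_divisor[OF assms(1)] by auto
  have "?p \<noteq> 2" using p assms(2) by auto
  then show "?p \<ge> 3" using p by linarith
  show pq: "?p * ?q = n" using p by simp
  have "?p \<noteq> n"
  proof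
    assume "?p = n"
    have "prime n"
    proof (rule prime_nat_iff[THEN iffD2], intro conjI allI impI)
      fix m assume m: "m dvd n"
      show "m = 1 \<or> m = n"
      proof (cases "m > 1")
        case True
        then have "n \<le> m" using least_divisor_le[OF assms(1) True m] \<open>?p = n\<close> by simp
        moreover have "m \<le> n" using m assms(1) by (intro dvd_imp_le) auto
        ultimately show ?thesis by simp
      next
        case False
        then show ?thesis using m assms(1) by (cases "m = 0") auto
      qed
    qed (use assms in auto)
    then show False using assms by simp
  qed
  have "?q \<noteq> 0"
  proof
    assume "?q = 0"
    then show False using pq assms(1) by simp
  qed
  moreover have "?q \<noteq> 1"
  proof
    assume "?q = 1"
    then show False using pq \<open>?p \<noteq> n\<close> by simp
  qed
  ultimately have "?q > 1" by linarith
  moreover have "?q dvd n" using pq by (metis dvd_triv_right)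
  ultimately show "?q \<ge> ?p" using least_divisor_le[OF assms(1)] by blast
qed

text \<open>Since (s - 1)(t - 1) = s t - (s + t) + 1 and the product is fixed, the inequality says p
  + q \<le> s + t. Among factorisations with both factors at least \<open>p\<close>, the sum is
  largest only for \<open>p\<close> and \<open>q\<close>.\<close>

lemma K_minus_parameters_unique:
  fixes p q s t :: nat
  assumes "p * q = s * t" "s \<ge> p" "t \<ge> p" "p \<ge> 1" and le: "(s - 1) * (t - 1) \<le> (p - 1) * (q - 1)"
    and "q \<ge> 1"
  shows "s = p \<and> t = q \<or> s = q \<and> t = p"
proof -
  obtain a b c d where abcd: "s = Suc a" "t = Suc b" "p = Suc c" "q = Suc d"
    using assms by (metis Suc_le_D One_nat_def le_trans)
  have "c * d + c + d = a * b + a + b" using assms(1) by (simp add: abcd)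
  moreover have "a * b \<le> c * d" using le by (simp add: abcd)
  ultimately have sum: "p + q \<le> s + t" by (simp add: abcd)
  have "(int s - int p) * (int s - int q) = int s * (int s + int t - int p - int q)"
    using arg_cong[OF assms(1), of int] by (simp add: algebra_simps)
  moreover have "\<dots> \<ge> 0" using sum by simp
  ultimately have prod: "(int s - int p) * (int s - int q) \<ge> 0" by simp
  show ?thesis
  proof (cases "s = p")
    case True
    then show ?thesis using assms by simp
  next
    case False
    then have "int s - int p > 0" using assms by simp
    then have "int s \<ge> int q" using prod by (simp add: zero_le_mult_iff)
    then have "s * t \<le> s * p" using assms(1) mult_le_mono2[of q s p] by (simp add: mult.commute)
    then have "t = p" using assms(2-4) by simp
    then show ?thesis using assms by simp
  qed
qed

text \<open>Since (s - 1) t = s t - t, the inequality says q \<le> t; with \<open>s \<ge> p\<close>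
  and equal products, both are equalities.\<close>

lemma K_plus_parameters_unique:
  fixes p q s t :: nat
  assumes "p * q = s * t" "s \<ge> p" "p \<ge> 1" "(s - 1) * t \<le> (p - 1) * q" "q \<ge> 1"
  shows "s = p \<and> t = q"
proof -
  obtain a c where ac: "s = Suc a" "p = Suc c" using assms by (metis Suc_le_D One_nat_def le_trans)
  have "q \<le> t" using assms(1,4) by (simp add: ac)
  then have "p * q \<le> p * t" by simp
  moreover have "p * t \<le> s * t" using assms by simp
  ultimately have "s * t = p * t" using assms(1) by linarith
  moreover have "t > 0" using \<open>q \<le> t\<close> assms(5) by linarith
  ultimately have "s = p" by simp
  then show ?thesis using assms by simp
qed

theorem theorem5p1:
  fixes G :: "'a pair_pre_digraph" and e :: nat
  assumes "pair_graph G"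
    and "bipartite G"
    and "card (edges G) = e"
    and "e \<ge> 4"
    and "no_isolated_vertices G"
    and "rho G = rho_max e"
  shows
    "let p' = least_divisor (e + 1); q' = (e + 1) div p';
         p'' = least_divisor (e - 1); q'' = (e - 1) div p''
     in (odd e \<longrightarrow> G \<simeq>\<^sub>G K_minus 2 ((e + 1) div 2)) \<and>
        (even e \<and> prime (e - 1) \<and> \<not> prime (e + 1) \<longrightarrow>
           p' \<ge> 3 \<and> G \<simeq>\<^sub>G K_minus p' q') \<and>
        (even e \<and> \<not> prime (e - 1) \<and> prime (e + 1) \<longrightarrow>
           p'' \<ge> 3 \<and> G \<simeq>\<^sub>G K_plus p'' q'') \<and>
        (even e \<and> \<not> prime (e - 1) \<and> \<not> prime (e + 1) \<longrightarrow>
           p' \<ge> 3 \<and> p'' \<ge> 3 \<and> (G \<simeq>\<^sub>G K_minus p' q' \<or> G \<simeq>\<^sub>G K_plus p'' q''))"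
proof -
  note G = \<open>pair_graph G\<close> and e = \<open>card (edges G) = e\<close> and e4 = \<open>e \<ge> 4\<close> and rho = \<open>rho G = rho_max e\<close>
  define p' q' p'' q'' where "p' = least_divisor (e + 1)" and "q' = (e + 1) div p'"
    and "p'' = least_divisor (e - 1)" and "q'' = (e - 1) div p''"
  obtain A B where AB: "bipartition G A B"
    using \<open>bipartite G\<close> unfolding bipartite_iff_bipartition by (elim exE)
  define D where "D = card (bad_pairs (arcs_between G A B))"
  \<comment> \<open>Comparison with \<open>K_minus s t\<close>: the block sizes are s - 1, t - 1, 1,
    1.\<close>
  have minus: "D \<le> 2 * ((s - 1) * (t - 1)) \<and> arcs_between G A B \<noteq> A \<times> B"
    if st: "s \<ge> 2" "t \<ge> 2" "s * t = e + 1" for s t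
  proof -
    obtain a b where ab: "s = Suc a" "t = Suc b" "a \<ge> 1" "b \<ge> 1"
      using st by (cases s; cases t) auto
    have "e = a * b + a * 1 + b * 1" using st(3) ab by simp
    then show ?thesis
      using extremal_graph_bounds[OF G AB rho e, of a b 1 1] ab by (simp add: D_def)
  qed
  \<comment> \<open>Comparison with \<open>K_plus s t\<close>: the removed biclique joins the
    pendant vertex to the other s - 1 vertices opposite to it.\<close>
  have plus: "D \<le> 2 * ((s - 1) * t) \<and> arcs_between G A B \<noteq> A \<times> B"
    if st: "s \<ge> 2" "t \<ge> 1" "s * t = e - 1" for s t
  proof -
    obtain a where a: "s = Suc a" "a \<ge> 1" using st by (cases s) auto
    have "e = 1 * t + 1 * 1 + t * a" using st(3) a e4 by (simp add: algebra_simps)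
    then show ?thesis
      using extremal_graph_bounds[OF G AB rho e, of 1 t a 1] a st by (simp add: D_def mult.commute)
  qed
  have cases: thesis
    if "D + 6 \<le> 2 * e" "arcs_between G A B \<noteq> A \<times> B"
      and "\<And>s t. \<lbrakk>s \<ge> 2; t \<ge> 2; s * t = e + 1; 2 * ((s - 1) * (t - 1)) \<le> D;
              G \<simeq>\<^sub>G K_minus s t; G \<simeq>\<^sub>G K_minus t s\<rbrakk> \<Longrightarrow> thesis"
      and "\<And>s t. \<lbrakk>s \<ge> 2; t \<ge> 1; s * t = e - 1; 2 * ((s - 1) * t) \<le> D;
              G \<simeq>\<^sub>G K_plus s t; s = 2 \<longrightarrow> G \<simeq>\<^sub>G K_minus 2 (t + 1)\<rbrakk> \<Longrightarrow> thesis" for thesis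
    using iso_K_minus_or_K_plus_if_few_bad_pairs[OF G AB \<open>no_isolated_vertices G\<close> that(2)] that(1,3,4)
    unfolding e D_def[symmetric] by (metis add_diff_cancel_right')
  have odd: "G \<simeq>\<^sub>G K_minus 2 ((e + 1) div 2)" if "odd e"
  proof -
    from that obtain m where m: "e = 2 * m + 1" by (rule oddE)
    have "m \<ge> 2" using m e4 by linarith
    have D: "D \<le> 2 * m" and ne: "arcs_between G A B \<noteq> A \<times> B"
      using minus[of 2 "m + 1"] m \<open>m \<ge> 2\<close> by auto
    have "G \<simeq>\<^sub>G K_minus 2 (m + 1)"
    proof (rule cases)
      show "D + 6 \<le> 2 * e" using D m \<open>m \<ge> 2\<close> by linarith
    next
      fix s t
      assume st: "s \<ge> 2" "t \<ge> 2" "s * t = e + 1" "2 * ((s - 1) * (t - 1)) \<le> D"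
        and iso: "G \<simeq>\<^sub>G K_minus s t" "G \<simeq>\<^sub>G K_minus t s"
      have "2 * (m + 1) = s * t" "(s - 1) * (t - 1) \<le> (2 - 1) * (m + 1 - 1)" using st D m by simp_all
      then have "s = 2 \<and> t = m + 1 \<or> s = m + 1 \<and> t = 2"
        using st by (intro K_minus_parameters_unique) auto
      then show ?thesis using iso by auto
    next
      fix s t
      assume st: "s \<ge> 2" "t \<ge> 1" "s * t = e - 1" "2 * ((s - 1) * t) \<le> D"
        and iso: "s = 2 \<longrightarrow> G \<simeq>\<^sub>G K_minus 2 (t + 1)"
      have "2 * m = s * t" "(s - 1) * t \<le> (2 - 1) * m" using st D m by simp_all
      \<comment> \<open>The \<open>K_plus\<close> outcome is forced to \<open>s = 2\<close>, where
        it is the same graph as \<open>K_minus 2 (m + 1)\<close>.\<close>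
      then have "s = 2 \<and> t = m" using st \<open>m \<ge> 2\<close> by (intro K_plus_parameters_unique) auto
      then show ?thesis using iso by auto
    qed (rule ne)
    then show ?thesis using m by simp
  qed
  have P': "p' \<ge> 3" "p' * q' = e + 1" "q' \<ge> p'" if "even e" "\<not> prime (e + 1)"
    using least_divisor_composite[of "e + 1"] that e4 by (simp_all add: p'_def q'_def)
  have P'': "p'' \<ge> 3" "p'' * q'' = e - 1" "q'' \<ge> p''" if "even e" "\<not> prime (e - 1)"
    using least_divisor_composite[of "e - 1"] that e4 by (simp_all add: p''_def q''_def)
  have min': "p' \<le> s" if "s \<ge> 2" "s * t = e + 1" for s t
    using least_divisor_le[of "e + 1" s] that e4 dvd_triv_left[of s t] by (simp add: p'_def)
  have min'': "p'' \<le> s" if "s \<ge> 2" "s * t = e - 1" for s t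
    using least_divisor_le[of "e - 1" s] that e4 dvd_triv_left[of s t] by (simp add: p''_def)
  have D': "D \<le> 2 * ((p' - 1) * (q' - 1))" "D + 8 \<le> 2 * e" "arcs_between G A B \<noteq> A \<times> B"
    if cond: "even e" "\<not> prime (e + 1)"
  proof -
    show 1: "D \<le> 2 * ((p' - 1) * (q' - 1))" and "arcs_between G A B \<noteq> A \<times> B"
      using minus[of p' q'] P'[OF that] by auto
    obtain a b where "p' = Suc a" "q' = Suc b" "a \<ge> 2" "b \<ge> 2"
      using P'[OF cond] by (cases p'; cases q') fastforce+
    then show "D + 8 \<le> 2 * e" using 1 P'(2)[OF cond] by simp
  qed
  have D'': "D \<le> 2 * ((p'' - 1) * q'')" "D + 8 \<le> 2 * e" "arcs_between G A B \<noteq> A \<times> B"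
    if cond: "even e" "\<not> prime (e - 1)"
  proof -
    show 1: "D \<le> 2 * ((p'' - 1) * q'')" and "arcs_between G A B \<noteq> A \<times> B"
      using plus[of p'' q''] P''[OF cond] by auto
    obtain a where "p'' = Suc a" using P''[OF cond] by (cases p'') auto
    then show "D + 8 \<le> 2 * e" using 1 P''[OF cond] by simp
  qed
  have minus_iso: "\<not> prime (e + 1) \<and> G \<simeq>\<^sub>G K_minus p' q'"
    if "even e" and st: "s \<ge> 2" "t \<ge> 2" "s * t = e + 1" "2 * ((s - 1) * (t - 1)) \<le> D"
      and iso: "G \<simeq>\<^sub>G K_minus s t" "G \<simeq>\<^sub>G K_minus t s" for s t
  proof -
    \<comment> \<open>Once \<open>e + 1\<close> is known to be composite,
      \<open>K_minus p' q'\<close> is available for comparison, even if the bound on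
      \<open>D\<close> so far came from \<open>e - 1\<close>.\<close>
    have np: "\<not> prime (e + 1)"
      using st(1-2) prime_product[of s t] unfolding st(3) by auto
    have "p' * q' = s * t" "(s - 1) * (t - 1) \<le> (p' - 1) * (q' - 1)"
      using P'(2)[OF that(1) np] D'(1)[OF that(1) np] st by simp_all
    moreover have "p' \<le> s" "p' \<le> t" using min'[of s t] min'[of t s] st by (simp_all add: mult.commute)
    ultimately have "s = p' \<and> t = q' \<or> s = q' \<and> t = p'"
      using P'[OF that(1) np] by (intro K_minus_parameters_unique) auto
    then show ?thesis using iso np by auto
  qed
  have plus_iso: "\<not> prime (e - 1) \<and> G \<simeq>\<^sub>G K_plus p'' q''"
    if "even e" and D8: "D + 8 \<le> 2 * e" and st: "s \<ge> 2" "t \<ge> 1" "s * t = e - 1" "2 * ((s - 1) * t) \<le> D"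
      and iso: "G \<simeq>\<^sub>G K_plus s t" for s t
  proof -
    have np: "\<not> prime (e - 1)"
    proof
      assume "prime (e - 1)"
      \<comment> \<open>A prime \<open>e - 1\<close> leaves only \<open>K_plus (e - 1) 1\<close>,
        which would require at least 2 (e - 2) bad pairs, against \<open>D8\<close>.\<close>
      then have "t = 1" using st(1) prime_product[of s t] unfolding st(3) by auto
      then show False using st D8 by simp
    qed
    have "p'' * q'' = s * t" "(s - 1) * t \<le> (p'' - 1) * q''"
      using P''(2)[OF that(1) np] D''(1)[OF that(1) np] st by simp_all
    moreover have "p'' \<le> s" using min''[of s t] st by simp
    ultimately have "s = p'' \<and> t = q''"
      using P''[OF that(1) np] by (intro K_plus_parameters_unique) auto
    then show ?thesis using iso np by auto
  qed
  \<comment> \<open>Each alternative carries its compositeness, so that primality of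
    \<open>e + 1\<close> or \<open>e - 1\<close> removes the corresponding one.\<close>
  have even: "\<not> prime (e + 1) \<and> G \<simeq>\<^sub>G K_minus p' q' \<or> \<not> prime (e - 1) \<and> G \<simeq>\<^sub>G K_plus p'' q''"
    if "even e" "\<not> prime (e + 1) \<or> \<not> prime (e - 1)"
  proof -
    have D8: "D + 8 \<le> 2 * e" and ne: "arcs_between G A B \<noteq> A \<times> B"
      using D' D'' that by auto
    show ?thesis
    proof (rule cases)
      show "D + 6 \<le> 2 * e" using D8 by simp
    qed (use ne minus_iso[OF that(1)] plus_iso[OF that(1) D8] in blast)+
  qed
  show ?thesis
    unfolding Let_def p'_def[symmetric] q'_def[symmetric] p''_def[symmetric] q''_def[symmetric]
    using odd even P'(1) P''(1) by blast
qed

end
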